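(* For every integer $n\ge 0$, $$\mathrm{SENO}(7n+5)\equiv 0 \pmod 7.$$
   Context: An overpartition of a nonnegative integer $n$ is a partition of $n$ (a finite non-increasing sequence of positive integers with sum $n$) in which, for each part size that occurs, the first occurrence of that size may be overlined or not; equivalently, it is a pair consisting of a partition into distinct (overlined) parts and an unrestricted partition (the non-overlined parts) with total sum $n$. $\mathrm{SENO}(n)$ denotes the sum of all the even non-overlined parts (counted with multiplicity) in all the overpartitions of $n$. *)

theory Defs
  imports "HOL-Library.Multiset" "HOL-Number_Theory.Cong"
begin

definition partitions :: "nat \<Rightarrow> nat list set" where
  "partitions n = {xs. sorted_wrt (\<ge>) xs \<and> 0 \<notin> set xs \<and> sum_list xs = n}"

text \<open>An overpartition is a pair \<open>(xs, S)\<close>: \<open>xs\<close> is the underlying partition and \<open>S\<close> is the set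
  of those part sizes whose first occurrence in \<open>xs\<close> is overlined.\<close>

definition overpartitions :: "nat \<Rightarrow> (nat list \<times> nat set) set" where
  "overpartitions n = {(xs, S). xs \<in> partitions n \<and> S \<subseteq> set xs}"

text \<open>For each size in \<open>S\<close> exactly one occurrence, the overlined one, is removed.\<close>

definition nonoverlined_parts :: "nat list \<times> nat set \<Rightarrow> nat multiset" where
  "nonoverlined_parts p = mset (fst p) - mset_set (snd p)"

definition SENO :: "nat \<Rightarrow> nat" where
  "SENO n = (\<Sum>p\<in>overpartitions n. \<Sum>\<^sub># (filter_mset even (nonoverlined_parts p)))"

text \<open>The sum defining \<^const>\<open>SENO\<close> is finite, so it does not take the default value 0.\<close>

lemma finite_partitions: "finite (partitions n)"
proof (rule finite_subset)
  show "partitions n \<subseteq> {xs. set xs \<subseteq> {..n} \<and> length xs \<le> n}"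
  proof
    fix xs assume "xs \<in> partitions n"
    then have pos: "0 \<notin> set xs" and n: "sum_list xs = n"
      by (simp_all add: partitions_def)
    have "length xs \<le> sum_list xs"
      using pos by (induction xs) auto
    moreover have "x \<le> n" if "x \<in> set xs" for x
      using member_le_sum_list[OF that] n by simp
    ultimately show "xs \<in> {xs. set xs \<subseteq> {..n} \<and> length xs \<le> n}"
      using n by auto
  qed
  show "finite {xs. set xs \<subseteq> {..n} \<and> length xs \<le> n}"
    by (rule finite_lists_length_le) simp
qed

lemma finite_overpartitions: "finite (overpartitions n)"
proof (rule finite_subset)
  show "overpartitions n \<subseteq> (SIGMA xs:partitions n. Pow (set xs))"
    by (auto simp: overpartitions_def)
  show "finite (SIGMA xs:partitions n. Pow (set xs))"
    using finite_partitions by simp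
qed

end

theory Submission
  imports Defs "HOL-Computational_Algebra.Formal_Power_Series" "HOL-Computational_Algebra.Polynomial"
begin

text \<open>
  Write \<open>f\<^sub>a\<close> for the product of all \<open>1 - q^(a i)\<close> with \<open>i \<ge> 1\<close>, let \<open>D = q d/dq\<close>, and let \<open>G\<close> be the
  generating function of \<open>SENO\<close>. The idea is to multiply \<open>G\<close> by \<open>f\<^sub>1^7\<close>, which modulo 7 is a
  series in \<open>q^7\<close>, and to write the result as a two-dimensional theta series in which every
  single term of exponent \<open>7 n + 5\<close> is divisible by 7.

  An overpartition is a multiset of non-overlined parts together with a set of overlined parts.
  Overpartitions therefore have the generating function \<open>f\<^sub>2 / f\<^sub>1\<^sup>2\<close>, and weighting each of them by the
  sum of its even non-overlined parts inserts the logarithmic derivative \<open>- D f\<^sub>2 / f\<^sub>2\<close>. Hence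
  \<open>G f\<^sub>1\<^sup>2 = - D f\<^sub>2\<close> (\<open>SENO_gf\<close>) and \<open>f\<^sub>1^7 G = - f\<^sub>1^5 D f\<^sub>2\<close>.

  The right-hand side is explicit. The fifth power factors as \<open>f\<^sub>1^5 = A f\<^sub>2\<^sup>2\<close>, where \<open>A\<close> is the sum over
  all integers \<open>j\<close> of \<open>(1 - 6 j) q^(j (3 j - 1) / 2)\<close> (\<open>euler_prod_power_5\<close>), so
  \<open>6 f\<^sub>1^5 D f\<^sub>2 = A D (2 f\<^sub>2\<^sup>3)\<close>. By Jacobi's identity \<open>2 f\<^sub>2\<^sup>3\<close> is the sum over all integers \<open>k\<close> of
  \<open>(-1)^k (1 - 2 k) q^(k (k - 1))\<close>. The terms of exponent \<open>N\<close> in \<open>A D (2 f\<^sub>2\<^sup>3)\<close> thus come from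
  pairs with \<open>24 N + 7 = x\<^sup>2 + 6 y\<^sup>2\<close>, where \<open>x = 6 j - 1\<close> and \<open>y = 2 k - 1\<close>, and their coefficients are
  multiples of \<open>(1 - 2 k) k (k - 1)\<close>, that is, up to a factor prime to 7, of \<open>y (y\<^sup>2 - 1)\<close>. For
  \<open>N = 7 n + 5\<close> the equation reads \<open>x\<^sup>2 = 1 + y\<^sup>2\<close> modulo 7. The squares modulo 7 are 0, 1, 2 and 4, so
  \<open>y\<^sup>2\<close> is 0 or 1 and the coefficient vanishes modulo 7 (\<open>seven_dvd_euler_prod_XD\<close>).

  Since \<open>D (F^p) = p F^(p-1) D F\<close>, the coefficients of \<open>f\<^sub>1^7\<close> at exponents prime to 7 are multiples of 7;
  its constant term is 1. So the divisibility passes from \<open>f\<^sub>1^7 G\<close> to \<open>G\<close> along the progression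
  (\<open>dvd_nth_if_dvd_nth_power_mult\<close>).

  The theta identities all come from one finite triple product identity
  (\<open>finite_jacobi_triple\<close>): Gauss's series for \<open>f\<^sub>1\<^sup>2 / f\<^sub>2\<close> and Euler's pentagonal number theorem by
  specialising \<open>z\<close> and passing to the limit, Jacobi's series for \<open>f\<^sub>1\<^sup>3\<close> by differentiating at \<open>z = 1\<close>.
  The factorisation of \<open>f\<^sub>1^5\<close> follows by multiplying Jacobi's series with Gauss's and
  splitting the resulting sum over a lattice into residue classes modulo 3.
\<close>

unbundle fps_syntax

section \<open>The finite form of Jacobi's triple product\<close>

fun qbinomial :: "'a::comm_ring_1 \<Rightarrow> nat \<Rightarrow> nat \<Rightarrow> 'a" where
  "qbinomial q M 0 = 1"
| "qbinomial q 0 (Suc j) = 0"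
| "qbinomial q (Suc M) (Suc j) = qbinomial q M j + q ^ Suc j * qbinomial q M (Suc j)"

definition qpoch :: "'a::comm_ring_1 \<Rightarrow> nat \<Rightarrow> 'a" where
  "qpoch q N = (\<Prod>i<N. 1 - q ^ Suc i)"

lemma qpoch_0 [simp]: "qpoch q 0 = 1"
  by (simp add: qpoch_def)

lemma qpoch_Suc: "qpoch q (Suc N) = qpoch q N * (1 - q ^ Suc N)"
  by (simp add: qpoch_def)

lemma qbinomial_eq_0: "M < j \<Longrightarrow> qbinomial q M j = 0"
  by (induction q M j rule: qbinomial.induct) auto

lemma qbinomial_self [simp]: "qbinomial q M M = 1"
  by (induction M) (auto simp: qbinomial_eq_0)

text \<open>The Pascal rule that is symmetric to the defining one; one rule adds a factor on the left, the
  other a factor on the right of the finite triple product.\<close>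

lemma qbinomial_Suc_right:
  assumes "j \<le> M"
  shows "qbinomial q (Suc M) (Suc j) = q ^ (M - j) * qbinomial q M j + qbinomial q M (Suc j)"
  using assms
proof (induction M arbitrary: j)
  case (Suc M)
  show ?case
  proof (cases "j = Suc M")
    case False
    hence j: "j \<le> M" using Suc.prems by simp
    show ?thesis
    proof (cases j)
      case 0
      show ?thesis
        using Suc.IH[of 0] by (simp add: 0 algebra_simps)
    next
      case (Suc i)
      have i: "Suc M - j = M - i" "M - i = Suc (M - j)" using j Suc by auto
      have q: "q ^ Suc j * q ^ (M - j) = q ^ (M - i) * q ^ j"
        by (simp add: i flip: power_add)
      have "qbinomial q (Suc (Suc M)) (Suc j) =
            qbinomial q (Suc M) j + q ^ Suc j * qbinomial q (Suc M) (Suc j)"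
        by simp
      also have "qbinomial q (Suc M) j = q ^ (M - i) * qbinomial q M i + qbinomial q M j"
        using Suc.IH[of i] Suc j by simp
      also have "qbinomial q (Suc M) (Suc j) = q ^ (M - j) * qbinomial q M j + qbinomial q M (Suc j)"
        using Suc.IH[of j] j by simp
      also have "q ^ (M - i) * qbinomial q M i + qbinomial q M j
                 + q ^ Suc j * (q ^ (M - j) * qbinomial q M j + qbinomial q M (Suc j))
               = q ^ (M - i) * qbinomial q M i + (q ^ Suc j * q ^ (M - j)) * qbinomial q M j
                 + (qbinomial q M j + q ^ Suc j * qbinomial q M (Suc j))"
        by (simp add: algebra_simps)
      also have "\<dots> = q ^ (M - i) * qbinomial q (Suc M) j + qbinomial q (Suc M) (Suc j)"
        unfolding q using Suc by (simp add: algebra_simps)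
      finally show ?thesis by (simp only: i(1))
    qed
  qed (simp add: qbinomial_eq_0)
qed auto

text \<open>The closed form of the Gaussian binomial with its denominators cleared, so that it makes sense
  over rings without division.\<close>

lemma qbinomial_mult_qpoch:
  "qbinomial q (i + j) i * qpoch q i * qpoch q j = qpoch q (i + j)"
proof (induction "i + j" arbitrary: i j)
  case (Suc n)
  show ?case
  proof (cases i)
    case (Suc i')
    show ?thesis
    proof (cases j)
      case (Suc j')
      note i = \<open>i = Suc i'\<close>
      have ih1: "qbinomial q (i' + j) i' * qpoch q i' * qpoch q j = qpoch q (i' + j)"
        using Suc.hyps(1)[of i' j] Suc.hyps(2) i by simp
      have ih2: "qbinomial q (i + j') i * qpoch q i * qpoch q j' = qpoch q (i + j')"
        using Suc.hyps(1)[of i j'] Suc.hyps(2) Suc by simp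
      have e: "i + j = Suc (i' + j)" "i + j' = i' + j" using i Suc by auto
      have "qbinomial q (i + j) i = qbinomial q (i' + j) i' + q ^ i * qbinomial q (i' + j) i"
        by (simp add: i)
      hence "qbinomial q (i + j) i * qpoch q i * qpoch q j =
            (qbinomial q (i' + j) i' * qpoch q i' * qpoch q j) * (1 - q ^ i)
          + q ^ i * (1 - q ^ j) * (qbinomial q (i + j') i * qpoch q i * qpoch q j')"
        by (simp only: e) (simp add: i Suc qpoch_Suc algebra_simps del: power_Suc)
      also have "\<dots> = qpoch q (i' + j) * (1 - q ^ (i + j))"
        unfolding ih1 ih2 unfolding e(2) by (simp add: algebra_simps power_add)
      finally show ?thesis by (simp only: e(1) qpoch_Suc)
    qed simp
  qed simp
qed simp

text \<open>For every integer \<open>k\<close> this is \<open>k (k - 1) / 2\<close>, which is never negative.\<close>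

definition tri :: "int \<Rightarrow> nat" where
  "tri k = nat (k * (k - 1) div 2)"

definition parity_sign :: "int \<Rightarrow> int" where
  "parity_sign k = (if even k then 1 else -1)"

lemma two_tri: "2 * int (tri k) = k * (k - 1)"
proof -
  have "k * (k - 1) \<ge> 0" by (cases "k \<ge> 1") (auto simp: mult_nonpos_nonpos)
  thus ?thesis by (simp add: tri_def)
qed

lemma tri_minus_one: "int (tri (k - 1)) = int (tri k) - (k - 1)"
  using two_tri[of k] two_tri[of "k - 1"] by (simp add: algebra_simps)

text \<open>The term of Cauchy's finite form of the triple product that carries \<open>z^j\<close>. The index of the
  bilateral sum is \<open>j - N\<close>; shifting it to \<open>j\<close> avoids negative powers of \<open>z\<close>.\<close>

definition jtp_term :: "'a::comm_ring_1 \<Rightarrow> 'a \<Rightarrow> nat \<Rightarrow> nat \<Rightarrow> nat \<Rightarrow> 'a" where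
  "jtp_term q z N M j = of_int (parity_sign (int j - int N)) * qbinomial q M j * q ^ tri (int j - int N) * z ^ j"

text \<open>Both numbers of factors grow one step at a time: a factor \<open>1 - z q^N'\<close> uses one Pascal rule, a
  factor \<open>z - q^(N+1)\<close> the other. No power of \<open>q\<close> or \<open>z\<close> has to be cancelled, so the identity
  holds in every commutative ring. This generality is used later for a polynomial ring, where \<open>z\<close>
  is the indeterminate.\<close>

lemma finite_jacobi_triple:
  fixes q z :: "'a::comm_ring_1"
  shows "(\<Prod>i<N. z - q ^ Suc i) * (\<Prod>i<N'. 1 - z * q ^ i) = (\<Sum>j\<le>N + N'. jtp_term q z N (N + N') j)"
proof (induction N)
  case 0
  show ?case
  proof (induction N')
    case (Suc N')
    have step: "jtp_term q z 0 (Suc N') (Suc j) = jtp_term q z 0 N' (Suc j) - z * q ^ N' * jtp_term q z 0 N' j"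
      if "j \<le> N'" for j
    proof -
      have t: "tri (int (Suc j)) = tri (int j) + j"
        using tri_minus_one[of "int (Suc j)"] by simp
      have e: "N' - j + (tri (int j) + j) = N' + tri (int j)" using that by simp
      have "q ^ (N' - j) * q ^ tri (int (Suc j)) = q ^ N' * q ^ tri (int j)"
        unfolding t power_add[symmetric] e ..
      moreover have "parity_sign (int (Suc j)) = - parity_sign (int j)" by (simp add: parity_sign_def)
      ultimately show ?thesis
        using qbinomial_Suc_right[OF that, of q]
        by (simp add: jtp_term_def algebra_simps del: qbinomial.simps of_nat_Suc)
    qed
    have "(\<Prod>i<Suc N'. 1 - z * q ^ i) = (\<Sum>j\<le>N'. jtp_term q z 0 N' j) * (1 - z * q ^ N')"
      using Suc by simp
    also have "\<dots> = (\<Sum>j\<le>Suc N'. jtp_term q z 0 N' j) - (\<Sum>j\<le>N'. z * q ^ N' * jtp_term q z 0 N' j)"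
      by (simp add: right_diff_distrib sum_subtractf sum_distrib_left mult.commute qbinomial_eq_0 jtp_term_def[of _ _ _ _ "Suc N'"])
    also have "(\<Sum>j\<le>Suc N'. jtp_term q z 0 N' j) = jtp_term q z 0 (Suc N') 0 + (\<Sum>j\<le>N'. jtp_term q z 0 N' (Suc j))"
      by (subst sum.atMost_Suc_shift) (simp add: jtp_term_def)
    also have "\<dots> - (\<Sum>j\<le>N'. z * q ^ N' * jtp_term q z 0 N' j) = 
        jtp_term q z 0 (Suc N') 0 + (\<Sum>j\<le>N'. jtp_term q z 0 (Suc N') (Suc j))"
      by (simp add: step sum_subtractf)
    also have "\<dots> = (\<Sum>j\<le>Suc N'. jtp_term q z 0 (Suc N') j)"
      by (subst sum.atMost_Suc_shift) simp
    finally show ?case by simp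
  qed (simp add: jtp_term_def parity_sign_def tri_def)
next
  case (Suc N)
  define M where "M = N + N'"
  have step: "jtp_term q z (Suc N) (Suc M) (Suc j) = z * jtp_term q z N M j - q ^ Suc N * jtp_term q z N M (Suc j)"
    if "j \<le> M" for j
  proof -
    define k where "k = int j - int N"
    have t: "int (tri (k + 1)) = int (tri k) + k"
      using tri_minus_one[of "k + 1"] by simp
    have k: "int (Suc j) - int (Suc N) = k" "int (Suc j) - int N = k + 1"
      by (auto simp: k_def)
    have "int (Suc N + tri (k + 1)) = int (Suc j + tri k)"
      using t by (simp add: k_def)
    hence e: "Suc N + tri (k + 1) = Suc j + tri k" by linarith
    have "q ^ Suc N * (of_int (parity_sign (k + 1)) * qbinomial q M (Suc j) * q ^ tri (k + 1) * z ^ Suc j) =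
          - (of_int (parity_sign k) * qbinomial q M (Suc j) * (q ^ Suc N * q ^ tri (k + 1)) * z ^ Suc j)"
      by (simp add: parity_sign_def mult_ac)
    also have "q ^ Suc N * q ^ tri (k + 1) = q ^ Suc j * q ^ tri k"
      unfolding power_add[symmetric] e ..
    finally show ?thesis
      unfolding jtp_term_def k k_def[symmetric] by (simp add: algebra_simps)
  qed
  have z0: "jtp_term q z (Suc N) (Suc M) 0 = - (q ^ Suc N * jtp_term q z N M 0)"
  proof -
    have "- int (Suc N) = - int N - 1" by simp
    hence "int (tri (- int (Suc N))) = int (Suc N + tri (- int N))"
      using tri_minus_one[of "- int N"] by (simp only:)
    hence "tri (- int (Suc N)) = Suc N + tri (- int N)" by linarith
    moreover have "parity_sign (- int (Suc N)) = - parity_sign (- int N)" by (simp add: parity_sign_def)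
    ultimately show ?thesis
      by (simp add: jtp_term_def power_add mult_ac del: of_nat_Suc)
  qed
  have "(\<Prod>i<Suc N. z - q ^ Suc i) * (\<Prod>i<N'. 1 - z * q ^ i) = (z - q ^ Suc N) * (\<Sum>j\<le>M. jtp_term q z N M j)"
    using Suc by (simp add: M_def algebra_simps)
  also have "\<dots> = (\<Sum>j\<le>M. z * jtp_term q z N M j) - (\<Sum>j\<le>Suc M. q ^ Suc N * jtp_term q z N M j)"
    by (simp add: left_diff_distrib sum_subtractf sum_distrib_left jtp_term_def qbinomial_eq_0)
  also have "(\<Sum>j\<le>Suc M. q ^ Suc N * jtp_term q z N M j) = 
     q ^ Suc N * jtp_term q z N M 0 + (\<Sum>j\<le>M. q ^ Suc N * jtp_term q z N M (Suc j))"
    by (subst sum.atMost_Suc_shift) (simp add: jtp_term_def)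
  also have "(\<Sum>j\<le>M. z * jtp_term q z N M j) - \<dots> =
     jtp_term q z (Suc N) (Suc M) 0 + (\<Sum>j\<le>M. jtp_term q z (Suc N) (Suc M) (Suc j))"
    by (simp add: z0 step sum_subtractf)
  also have "\<dots> = (\<Sum>j\<le>Suc M. jtp_term q z (Suc N) (Suc M) j)"
    by (subst sum.atMost_Suc_shift) simp
  finally show ?case by (simp add: M_def)
qed

section \<open>Euler products as limits of formal power series\<close>

text \<open>A coefficient of a product depends on finitely many coefficients of the factors, and each of
  these is eventually constant.\<close>

lemma tendsto_fps_mult:
  fixes f g :: "'b \<Rightarrow> 'a::ring_1 fps"
  assumes "(f \<longlongrightarrow> F) L" "(g \<longlongrightarrow> G) L"
  shows "((\<lambda>x. f x * g x) \<longlongrightarrow> F * G) L"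
proof (rule tendsto_fpsI)
  fix n
  have "eventually (\<lambda>x. \<forall>i\<in>{..n}. f x $ i = F $ i \<and> g x $ i = G $ i) L"
    using assms unfolding tendsto_fps_iff
    by (intro eventually_ball_finite) (auto intro: eventually_conj)
  thus "eventually (\<lambda>x. (f x * g x) $ n = (F * G) $ n) L"
    by eventually_elim (auto simp: fps_mult_nth intro!: sum.cong)
qed

lemma tendsto_fps_add:
  fixes f g :: "'b \<Rightarrow> 'a::ring_1 fps"
  assumes "(f \<longlongrightarrow> F) L" "(g \<longlongrightarrow> G) L"
  shows "((\<lambda>x. f x + g x) \<longlongrightarrow> F + G) L"
proof (rule tendsto_fpsI)
  fix n
  from assms have "eventually (\<lambda>x. f x $ n = F $ n) L" "eventually (\<lambda>x. g x $ n = G $ n) L"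
    unfolding tendsto_fps_iff by auto
  thus "eventually (\<lambda>x. (f x + g x) $ n = (F + G) $ n) L"
    by eventually_elim simp
qed

text \<open>Cancellation of a factor with constant term 1 when the products are known to agree only up to
  some degree.\<close>

lemma fps_mult_cancel_upto:
  fixes F g h :: "'a::comm_ring_1 fps"
  assumes "F $ 0 = 1" "\<And>i. i \<le> n \<Longrightarrow> (F * g) $ i = (F * h) $ i" "i \<le> n"
  shows "g $ i = h $ i"
  using assms(3)
proof (induction i rule: less_induct)
  case (less i)
  have split: "(F * u) $ i = u $ i + (\<Sum>k\<in>{0<..i}. F $ k * u $ (i - k))" for u
  proof -
    have "{0..i} = insert 0 {0<..i}" by auto
    thus ?thesis by (simp add: fps_mult_nth assms(1))
  qed
  have "(\<Sum>k\<in>{0<..i}. F $ k * g $ (i - k)) = (\<Sum>k\<in>{0<..i}. F $ k * h $ (i - k))"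
    using less by (intro sum.cong) auto
  thus ?case using split[of g] split[of h] assms(2)[of i] less.prems by simp
qed

text \<open>The infinite product of all \<open>1 - X^(a i)\<close> with \<open>i \<ge> 1\<close>: for \<open>a > 0\<close> later factors do not affect the
  coefficient at \<open>n\<close>, so it can be read off from the first \<open>n\<close> factors.\<close>

definition euler_prod :: "nat \<Rightarrow> int fps" where
  "euler_prod a = Abs_fps (\<lambda>n. qpoch (fps_X ^ a) n $ n)"

lemma qpoch_nth:
  assumes "a > 0" "n \<le> N"
  shows "qpoch (fps_X ^ a) N $ n = euler_prod a $ n"
  using assms(2)
proof (induction N rule: dec_induct)
  case (step N)
  have "n < a * Suc N" using step(1) assms(1) by (metis Suc_le_mono le_trans less_eq_Suc_le mult_le_mono1 nat_mult_1 One_nat_def)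
  hence "(qpoch (fps_X ^ a) N * fps_X ^ (a * Suc N)) $ n = (0::int)"
    by (simp add: fps_X_power_mult_right_nth del: mult_Suc_right)
  thus ?case using step.IH
    by (simp add: qpoch_Suc right_diff_distrib flip: power_mult power_Suc del: mult_Suc_right)
qed (simp add: euler_prod_def)

lemma qpoch_tendsto: "a > 0 \<Longrightarrow> (qpoch (fps_X ^ a) \<longlongrightarrow> euler_prod a) sequentially"
proof (rule tendsto_fpsI)
  fix n assume "a > 0"
  thus "eventually (\<lambda>N. qpoch (fps_X ^ a) N $ n = euler_prod a $ n) sequentially"
    by (intro eventually_mono[OF eventually_ge_at_top[of n]] qpoch_nth)
qed

lemma euler_prod_0 [simp]: "euler_prod a $ 0 = 1"
  by (simp add: euler_prod_def)

lemma euler_prod_nonzero [simp]: "euler_prod a \<noteq> 0"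
  by (metis euler_prod_0 fps_zero_nth zero_neq_one)

text \<open>The Gaussian binomial tends to the reciprocal of the Euler product when both of its lower
  parameters grow: in \<open>qbinomial_mult_qpoch\<close> each finite product may be replaced by the infinite one
  up to degree \<open>n\<close>, and one Euler product cancels.\<close>

lemma qbinomial_mult_euler_prod_nth:
  assumes "a > 0" "n \<le> i" "n \<le> j" "r \<le> n"
  shows "(qbinomial (fps_X ^ a) (i + j) i * euler_prod a) $ r = 1 $ r"
proof (rule fps_mult_cancel_upto[of "euler_prod a" n])
  fix r assume "r \<le> n"
  let ?b = "qbinomial (fps_X ^ a) (i + j) i :: int fps"
  have "(?b * euler_prod a * euler_prod a) $ r = (?b * qpoch (fps_X ^ a) i * qpoch (fps_X ^ a) j) $ r"
    unfolding fps_mult_nth[of _ _ r] fps_mult_nth[of ?b]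
    using assms(2,3) \<open>r \<le> n\<close> by (intro sum.cong refl arg_cong2[of _ _ _ _ "(*)"]) (auto simp: qpoch_nth[OF assms(1)])
  also have "\<dots> = euler_prod a $ r"
    unfolding qbinomial_mult_qpoch using assms(2) \<open>r \<le> n\<close> by (simp add: qpoch_nth[OF assms(1)])
  finally show "(euler_prod a * (?b * euler_prod a)) $ r = (euler_prod a * 1) $ r"
    by (simp add: mult_ac)
qed (use assms in auto)

section \<open>Power series indexed by arbitrary sets\<close>

text \<open>The formal sum of \<open>w i X^(e i)\<close> over \<open>i \<in> I\<close>. Integers, pairs of integers, multisets and sets of parts
  all occur as indices, so that theta series and partition generating functions obey the same
  rules for products and changes of variables. The sum is meaningful when only finitely many
  indices share an exponent.\<close>

definition gf :: "'i set \<Rightarrow> ('i \<Rightarrow> int) \<Rightarrow> ('i \<Rightarrow> nat) \<Rightarrow> int fps" where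
  "gf I w e = Abs_fps (\<lambda>n. \<Sum>i | i \<in> I \<and> e i = n. w i)"

definition finite_fibres :: "'i set \<Rightarrow> ('i \<Rightarrow> nat) \<Rightarrow> bool" where
  "finite_fibres I e \<longleftrightarrow> (\<forall>n. finite {i \<in> I. e i = n})"

lemma gf_nth: "gf I w e $ n = (\<Sum>i | i \<in> I \<and> e i = n. w i)"
  by (simp add: gf_def)

lemma prod_fibre:
  "{x \<in> I \<times> J. (case x of (i, j) \<Rightarrow> e i + d j) = n} =
   (\<Union>k\<in>{0..n}. {i \<in> I. e i = k} \<times> {j \<in> J. d j = n - k})"
  for n :: nat
  by auto

lemma finite_fibres_times:
  "finite_fibres I e \<Longrightarrow> finite_fibres J d \<Longrightarrow> finite_fibres (I \<times> J) (\<lambda>(i, j). e i + d j)"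
  unfolding finite_fibres_def prod_fibre by blast

lemma gf_mult:
  assumes "finite_fibres I e" "finite_fibres J d"
  shows "gf I w e * gf J v d = gf (I \<times> J) (\<lambda>(i, j). w i * v j) (\<lambda>(i, j). e i + d j)"
proof (rule fps_ext)
  fix n
  have fin: "finite {i \<in> I. e i = k}" "finite {j \<in> J. d j = k}" for k
    using assms by (auto simp: finite_fibres_def)
  have "(\<Sum>x | x \<in> I \<times> J \<and> (case x of (i, j) \<Rightarrow> e i + d j) = n. case x of (i, j) \<Rightarrow> w i * v j) =
        (\<Sum>k\<in>{0..n}. \<Sum>x\<in>{i \<in> I. e i = k} \<times> {j \<in> J. d j = n - k}. case x of (i, j) \<Rightarrow> w i * v j)"
    unfolding prod_fibre using fin by (intro sum.UNION_disjoint) auto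
  also have "\<dots> = (gf I w e * gf J v d) $ n"
    by (simp add: fps_mult_nth gf_nth sum_product sum.cartesian_product)
  finally show "(gf I w e * gf J v d) $ n =
      gf (I \<times> J) (\<lambda>(i, j). w i * v j) (\<lambda>(i, j). e i + d j) $ n"
    by (simp add: gf_nth)
qed

lemma gf_reindex:
  assumes "bij_betw h J I" "\<And>j. j \<in> J \<Longrightarrow> v j = w (h j)" "\<And>j. j \<in> J \<Longrightarrow> d j = e (h j)"
  shows "gf J v d = gf I w e"
proof (rule fps_ext)
  fix n
  have "bij_betw h {j \<in> J. d j = n} {i \<in> I. e i = n}"
    using assms(1,3) unfolding bij_betw_def inj_on_def by auto
  from sum.reindex_bij_betw[OF this, of w] show "gf J v d $ n = gf I w e $ n"
    using assms(2) by (simp add: gf_nth cong: conj_cong)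
qed

lemma gf_add: "gf I (\<lambda>i. w i + v i) e = gf I w e + gf I v e"
  by (rule fps_ext) (simp add: gf_nth sum.distrib)

lemma of_int_mult_nth: "(of_int c * (f :: int fps)) $ n = c * f $ n"
  unfolding fps_of_int[symmetric] by simp

lemma gf_cmult: "gf I (\<lambda>i. c * w i) e = of_int c * gf I w e"
  by (rule fps_ext) (simp add: gf_nth sum_distrib_left of_int_mult_nth)

lemma gf_uminus: "gf I (\<lambda>i. - w i) e = - gf I w e"
  by (rule fps_ext) (simp add: gf_nth sum_negf)

lemma gf_Un_disjoint:
  assumes "finite_fibres (I \<union> J) e" "I \<inter> J = {}"
  shows "gf (I \<union> J) w e = gf I w e + gf J w e"
proof (rule fps_ext)
  fix n
  have "finite {i \<in> I \<union> J. e i = n}" using assms by (auto simp: finite_fibres_def)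
  moreover have "{i \<in> I \<union> J. e i = n} = {i \<in> I. e i = n} \<union> {i \<in> J. e i = n}" by auto
  ultimately show "gf (I \<union> J) w e $ n = (gf I w e + gf J w e) $ n"
    using assms(2) by (auto simp: gf_nth intro!: sum.union_disjoint)
qed

text \<open>The involution shows that the series equals its own negative.\<close>

lemma gf_involution_eq_0:
  assumes "bij_betw h I I" "\<And>i. i \<in> I \<Longrightarrow> w (h i) = - w i" "\<And>i. i \<in> I \<Longrightarrow> e (h i) = e i"
  shows "gf I w e = 0"
proof -
  have "gf I (\<lambda>i. - w i) e = gf I w e"
    using assms by (intro gf_reindex[of h]) auto
  thus ?thesis
    by (simp add: gf_uminus fps_eq_iff)
qed

lemma XD_gf: "fps_XD (gf I w e) = gf I (\<lambda>i. int (e i) * w i) e"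
  by (rule fps_ext) (simp add: gf_nth sum_distrib_left)

lemma finite_fibres_linear_growth:
  assumes "\<And>k. \<bar>k\<bar> \<le> int (e k) + 1"
  shows "finite_fibres (UNIV :: int set) e"
  unfolding finite_fibres_def
proof
  fix n
  have "{i \<in> UNIV. e i = n} \<subseteq> {- int n - 1..int n + 1}"
  proof
    fix i assume "i \<in> {i \<in> UNIV. e i = n}"
    thus "i \<in> {- int n - 1..int n + 1}" using assms[of i] by auto
  qed
  thus "finite {i \<in> UNIV. e i = n}" by (rule finite_subset) simp
qed

lemma gf_shift:
  assumes "bij_betw h I J" "\<And>i. i \<in> I \<Longrightarrow> e (h i) = e i + m"
  shows "gf J w e = fps_X ^ m * gf I (\<lambda>i. w (h i)) e"
proof -
  have "gf J w e = gf I (\<lambda>i. w (h i)) (\<lambda>i. e i + m)"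
    by (rule gf_reindex[OF assms(1), symmetric]) (simp_all add: assms(2))
  also have "\<dots> = fps_X ^ m * gf I (\<lambda>i. w (h i)) e"
  proof (rule fps_ext)
    fix n
    have "{i \<in> I. e i + m = n} = (if n < m then {} else {i \<in> I. e i = n - m})" by auto
    thus "gf I (\<lambda>i. w (h i)) (\<lambda>i. e i + m) $ n = (fps_X ^ m * gf I (\<lambda>i. w (h i)) e) $ n"
      by (simp add: gf_nth fps_X_power_mult_nth)
  qed
  finally show ?thesis .
qed

section \<open>Theta series of Jacobi, Gauss and Euler\<close>

text \<open>The passage to the limit in finite triple products. By the growth condition only indices \<open>k\<close> with
  \<open>\<bar>k\<bar> \<le> n + 1\<close> matter for the coefficient at \<open>n\<close>, and for these the Gaussian binomial times the
  Euler product is 1 up to degree \<open>n\<close> once \<open>N \<ge> 2 n + 1\<close>. The shift \<open>c\<close> admits both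
  balanced products and products with one extra factor.\<close>

lemma qbinomial_sum_tendsto:
  assumes "a > 0" "\<And>k. \<bar>k\<bar> \<le> int (e k) + 1"
  shows "((\<lambda>N. (\<Sum>j\<le>N + (N + c). of_int (w (int j - int N)) * qbinomial (fps_X ^ a) (N + (N + c)) j
                 * fps_X ^ e (int j - int N)) * euler_prod a)
          \<longlongrightarrow> gf UNIV w e) sequentially"
proof (rule tendsto_fpsI)
  fix n
  show "eventually (\<lambda>N. ((\<Sum>j\<le>N + (N + c). of_int (w (int j - int N)) * qbinomial (fps_X ^ a) (N + (N + c)) j
                 * fps_X ^ e (int j - int N)) * euler_prod a) $ n = gf UNIV w e $ n) sequentially"
    using eventually_ge_at_top[of "2 * n + 1"]
  proof eventually_elim
    fix N :: nat assume N: "2 * n + 1 \<le> N"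
    define M where "M = N + (N + c)"
    define k where "k = (\<lambda>j. int j - int N)"
    let ?b = "\<lambda>j. qbinomial (fps_X ^ a) M j * euler_prod a"
    have summand: "(of_int (w (k j)) * qbinomial (fps_X ^ a) M j * fps_X ^ e (k j) * euler_prod a) $ n
              = (if e (k j) = n then w (k j) else 0)" if "j \<le> M" for j
    proof -
      have "(of_int (w (k j)) * qbinomial (fps_X ^ a) M j * fps_X ^ e (k j) * euler_prod a) $ n
          = w (k j) * (?b j * fps_X ^ e (k j)) $ n"
        unfolding of_int_mult_nth[symmetric] by (simp add: mult_ac)
      also have "\<dots> = (if n < e (k j) then 0 else w (k j) * ?b j $ (n - e (k j)))"
        by (simp add: fps_X_power_mult_right_nth)
      also have "\<dots> = (if e (k j) = n then w (k j) else 0)"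
      proof (cases "n < e (k j)")
        case False
        have "\<bar>k j\<bar> \<le> int n + 1" using assms(2)[of "k j"] False by linarith
        hence "n \<le> j" "n \<le> M - j" using N that by (auto simp: k_def M_def)
        from qbinomial_mult_euler_prod_nth[OF assms(1) this, of "n - e (k j)"] that
        have "?b j $ (n - e (k j)) = 1 $ (n - e (k j))" by simp
        thus ?thesis using False by (auto simp: fps_one_nth)
      qed auto
      finally show ?thesis .
    qed
    have "((\<Sum>j\<le>M. of_int (w (k j)) * qbinomial (fps_X ^ a) M j * fps_X ^ e (k j)) * euler_prod a) $ n =
          (\<Sum>j\<le>M. if e (k j) = n then w (k j) else 0)"
      unfolding sum_distrib_right fps_sum_nth by (intro sum.cong refl summand) simp
    also have "\<dots> = (\<Sum>j | j \<le> M \<and> e (k j) = n. w (k j))"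
      by (simp add: sum.inter_filter[symmetric])
    also have "\<dots> = gf UNIV w e $ n"
      unfolding gf_nth
    proof (rule sum.reindex_bij_betw)
      have "\<exists>j\<le>M. i = k j" if "e i = n" for i
        using assms(2)[of i] N that by (intro exI[of _ "nat (i + int N)"]) (auto simp: k_def M_def)
      thus "bij_betw k {j. j \<le> M \<and> e (k j) = n} {i. i \<in> UNIV \<and> e i = n}"
        unfolding bij_betw_def by (auto simp: inj_on_def k_def)
    qed
    finally show "((\<Sum>j\<le>N + (N + c). of_int (w (int j - int N)) * qbinomial (fps_X ^ a) (N + (N + c)) j
                 * fps_X ^ e (int j - int N)) * euler_prod a) $ n = gf UNIV w e $ n"
      by (simp add: M_def k_def)
  qed
qed

text \<open>The exponent \<open>a k (k - 1) / 2 + b k\<close> of \<open>X\<close> in the triple product with \<open>q = X^a\<close> and \<open>z = X^b\<close>. It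
  is nonnegative for \<open>b \<le> a\<close>.\<close>

definition theta_exp :: "nat \<Rightarrow> nat \<Rightarrow> int \<Rightarrow> nat" where
  "theta_exp a b k = nat (int a * int (tri k) + int b * k)"

lemma tri_growth: "\<bar>k\<bar> \<le> int (tri k) + 1" "\<bar>k\<bar> \<le> int (tri k) + k + 1"
proof -
  have *: "\<bar>k\<bar> \<le> int (tri k) + 1" for k
  proof (cases "k \<ge> 1")
    case True
    have "(k - 1) * (k - 2) \<ge> 0" by (cases "k = 1") (use True in auto)
    thus ?thesis using two_tri[of k] True by (simp add: algebra_simps)
  next
    case False
    have "(-k) * (-k-1) \<ge> 0"
    proof (cases "k = 0")
      case False
      hence "-k \<ge> 0" "-k-1 \<ge> 0" using \<open>\<not> k \<ge> 1\<close> by auto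
      thus ?thesis by (rule mult_nonneg_nonneg)
    qed simp
    thus ?thesis using two_tri[of k] False by (simp add: algebra_simps)
  qed
  show "\<bar>k\<bar> \<le> int (tri k) + 1" by (rule *)
  show "\<bar>k\<bar> \<le> int (tri k) + k + 1"
    using *[of "- k"] two_tri[of k] two_tri[of "- k"] by (simp add: algebra_simps)
qed

lemma theta_exp:
  assumes "0 < a" "b \<le> a"
  shows "int (theta_exp a b k) = int a * int (tri k) + int b * k" and "\<bar>k\<bar> \<le> int (theta_exp a b k) + 1"
proof -
  have T: "int a * int (tri k) \<ge> int (tri k)"
    using mult_right_mono[of 1 "int a" "int (tri k)"] assms(1) by simp
  have "int (tri k) + k \<ge> 0" using tri_minus_one[of "k + 1"] by simp
  hence T': "int a * (int (tri k) + k) \<ge> int (tri k) + k" using mult_right_mono[of 1 "int a" "int (tri k) + k"] assms(1) by simp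
  have *: "int a * int (tri k) + int b * k \<ge> \<bar>k\<bar> - 1 \<and> int a * int (tri k) + int b * k \<ge> 0"
  proof (cases "k \<ge> 0")
    case True
    hence "int b * k \<ge> 0" by simp
    thus ?thesis using T tri_growth(1)[of k] by linarith
  next
    case False
    hence "(int a - int b) * (-k) \<ge> 0" using assms(2) by (intro mult_nonneg_nonneg) auto
    thus ?thesis using T' tri_growth(2)[of k] \<open>int (tri k) + k \<ge> 0\<close> by (simp add: algebra_simps)
  qed
  thus "int (theta_exp a b k) = int a * int (tri k) + int b * k" by (simp add: theta_exp_def)
  thus "\<bar>k\<bar> \<le> int (theta_exp a b k) + 1" using * by linarith
qed

lemma theta_exp_0: "theta_exp a 0 k = a * tri k"
  by (simp add: theta_exp_def nat_mult_distrib)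

text \<open>The finite triple product at \<open>q = X^a\<close>, \<open>z = X^b\<close>. Each of the first \<open>N\<close> factors \<open>z - q^(i+1)\<close> contains
  \<open>X^b\<close>; the common power \<open>X^(b N)\<close> cancels and turns the shifted sum into a bilateral one.\<close>

lemma jacobi_triple_limit:
  assumes "0 < a" "b \<le> a"
  shows "((\<lambda>N. (\<Prod>i<N. 1 - fps_X ^ (a * Suc i - b)) * (\<Prod>i<N. 1 - fps_X ^ (a * i + b)) * euler_prod a)
           \<longlongrightarrow> gf UNIV parity_sign (theta_exp a b)) sequentially"
proof -
  have "(\<Prod>i<N. 1 - fps_X ^ (a * Suc i - b)) * (\<Prod>i<N. 1 - fps_X ^ (a * i + b)) =
        (\<Sum>j\<le>N + (N + 0). of_int (parity_sign (int j - int N)) * qbinomial (fps_X ^ a) (N + (N + 0)) j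
                 * fps_X ^ theta_exp a b (int j - int N) :: int fps)" (is "?P = ?S") for N
  proof -
    have "fps_X ^ (b * N) * ?P =
          (\<Prod>i<N. fps_X ^ b - (fps_X ^ a) ^ Suc i) * (\<Prod>i<N. 1 - fps_X ^ b * (fps_X ^ a) ^ i)"
    proof -
      have "fps_X ^ b - (fps_X ^ a) ^ Suc i = fps_X ^ b * (1 - fps_X ^ (a * Suc i - b) :: int fps)" for i
      proof -
        have "a * Suc i = b + (a * Suc i - b)" using assms(2) by simp
        hence "(fps_X ^ a) ^ Suc i = fps_X ^ b * (fps_X ^ (a * Suc i - b) :: int fps)"
          by (metis power_add power_mult)
        thus ?thesis by (simp add: right_diff_distrib)
      qed
      hence 1: "(\<Prod>i<N. fps_X ^ b - (fps_X ^ a) ^ Suc i :: int fps) = 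
          (\<Prod>i<N. fps_X ^ b) * (\<Prod>i<N. (1 - fps_X ^ (a * Suc i - b)))"
        by (simp only: prod.distrib)
      show ?thesis
        unfolding 1
        by (simp only: prod_constant card_lessThan power_mult[symmetric] power_add[symmetric]
            add.commute mult.assoc)
    qed
    also have "\<dots> = (\<Sum>j\<le>N + N. jtp_term (fps_X ^ a) (fps_X ^ b) N (N + N) j)"
      by (rule finite_jacobi_triple)
    also have "\<dots> = fps_X ^ (b * N) * ?S"
      unfolding sum_distrib_left
    proof (intro sum.cong)
      fix j
      have "int (a * tri (int j - int N) + b * j) = int (b * N + theta_exp a b (int j - int N))"
        by (simp add: theta_exp[OF assms] algebra_simps)
      hence "a * tri (int j - int N) + b * j = b * N + theta_exp a b (int j - int N)"
        by linarith
      hence "(fps_X ^ a) ^ tri (int j - int N) * (fps_X ^ b) ^ j =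
             fps_X ^ (b * N) * (fps_X ^ theta_exp a b (int j - int N) :: int fps)"
        by (metis power_add power_mult)
      thus "jtp_term (fps_X ^ a) (fps_X ^ b) N (N + N) j = 
         fps_X ^ (b * N) * (of_int (parity_sign (int j - int N)) * qbinomial (fps_X ^ a) (N + (N + 0)) j
                 * fps_X ^ theta_exp a b (int j - int N) :: int fps)"
        by (simp add: jtp_term_def mult_ac)
    qed auto
    finally show ?thesis by simp
  qed
  thus ?thesis
    using qbinomial_sum_tendsto[where e = "theta_exp a b" and c = 0 and w = parity_sign] theta_exp(2)[OF assms] assms(1) by simp
qed

lemma qbinomial_const_poly: "qbinomial [:q:] M j = [:qbinomial q M j:]"
  by (induction q M j rule: qbinomial.induct) (auto simp: power_0_left one_pCons poly_const_pow mult_to_poly)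

lemma pderiv_sum: "pderiv (\<Sum>i\<in>A. f i) = (\<Sum>i\<in>A. pderiv (f i))"
  by (induction A rule: infinite_finite_induct) (simp_all add: pderiv_add)

text \<open>Here \<open>z\<close> is an indeterminate over the power series, and the product with \<open>N + 1\<close> factors
  \<open>1 - z q^i\<close> contains \<open>1 - z\<close>. So it vanishes at \<open>z = 1\<close>, and its derivative there is minus the product
  of the other factors.\<close>

lemma finite_jacobi_derivative:
  fixes q :: "int fps"
  defines "c \<equiv> \<lambda>N j. of_int (parity_sign (int j - int N)) * qbinomial q (N + (N + 1)) j * q ^ tri (int j - int N)"
  shows "(\<Sum>j\<le>N + (N + 1). c N j) = 0"
    and "(\<Sum>j\<le>N + (N + 1). of_nat j * c N j) = - (qpoch q N)\<^sup>2"
proof -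
  define z :: "int fps poly" where "z = [:0, 1:]"
  define Q where "Q = (\<Prod>i<N. z - [:q:] ^ Suc i) * (\<Prod>i<N. 1 - z * [:q:] ^ Suc i)"
  have c: "jtp_term [:q:] z N (N + (N + 1)) j = monom (c N j) j" for j
  proof -
    have "z ^ j = monom 1 j" by (simp add: z_def monom_altdef)
    thus ?thesis
      by (simp add: jtp_term_def c_def of_int_poly qbinomial_const_poly poly_const_pow smult_monom mult_ac)
  qed
  have eq: "(1 - z) * Q = (\<Sum>j\<le>N + (N + 1). monom (c N j) j)"
  proof -
    have "(\<Prod>i<N + 1. 1 - z * [:q:] ^ i) = (1 - z) * (\<Prod>i<N. 1 - z * [:q:] ^ Suc i)"
      unfolding Suc_eq_plus1[symmetric] prod.lessThan_Suc_shift by simp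
    thus ?thesis
      using finite_jacobi_triple[of z "[:q:]" N "N + 1"] by (simp only: c Q_def mult_ac)
  qed
  have z1: "poly z 1 = 1" "pderiv z = 1" by (simp_all add: z_def pderiv_pCons)
  have Q1: "poly Q 1 = (qpoch q N)\<^sup>2"
    by (simp add: Q_def poly_prod z1 qpoch_def power2_eq_square poly_const_pow mult_ac)
  show "(\<Sum>j\<le>N + (N + 1). c N j) = 0"
    using arg_cong[OF eq, of "\<lambda>p. poly p 1"] z1 by (simp add: poly_sum poly_monom del: sum.atMost_Suc)
  show "(\<Sum>j\<le>N + (N + 1). of_nat j * c N j) = - (qpoch q N)\<^sup>2"
    using arg_cong[OF eq, of "\<lambda>p. poly (pderiv p) 1"]
    by (simp add: poly_sum poly_monom pderiv_sum pderiv_monom pderiv_mult pderiv_diff z1 Q1 del: sum.atMost_Suc)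
qed

text \<open>With \<open>j = k + N\<close> the weight \<open>1 - 2 k\<close> equals \<open>(2 N + 1) - 2 j\<close>. The two sums of
  \<open>finite_jacobi_derivative\<close> combine accordingly to twice the square of the finite product, and
  the limit supplies the third factor.\<close>

lemma jacobi_cube:
  assumes "a > 0"
  shows "2 * euler_prod a ^ 3 = gf UNIV (\<lambda>k. parity_sign k * (1 - 2 * k)) (theta_exp a 0)"
proof -
  define w where "w = (\<lambda>k. parity_sign k * (1 - 2 * k))"
  have "(\<Sum>j\<le>N + (N + 1). of_int (w (int j - int N)) * qbinomial (fps_X ^ a) (N + (N + 1)) j
                 * fps_X ^ theta_exp a 0 (int j - int N)) = 2 * (qpoch (fps_X ^ a) N :: int fps)\<^sup>2" (is "?S = _") for N
  proof -
    define c :: "nat \<Rightarrow> int fps" where "c = (\<lambda>j. of_int (parity_sign (int j - int N)) * qbinomial (fps_X ^ a) (N + (N + 1)) j * (fps_X ^ a) ^ tri (int j - int N))"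
    have "?S = (\<Sum>j\<le>N + (N + 1). (of_nat (2 * N + 1) * c j - 2 * (of_nat j * c j)))"
      by (intro sum.cong) (auto simp: c_def w_def theta_exp_0 power_mult algebra_simps)
    also have "\<dots> = of_nat (2 * N + 1) * (\<Sum>j\<le>N + (N + 1). c j) - 2 * (\<Sum>j\<le>N + (N + 1). of_nat j * c j)"
      by (simp only: sum_subtractf sum_distrib_left)
    also have "\<dots> = 2 * (qpoch (fps_X ^ a) N)\<^sup>2"
      using finite_jacobi_derivative[where q = "fps_X ^ a" and N = N] by (simp only: c_def) simp
    finally show ?thesis .
  qed
  hence "((\<lambda>N. 2 * (qpoch (fps_X ^ a) N)\<^sup>2 * euler_prod a) \<longlongrightarrow> gf UNIV w (theta_exp a 0)) sequentially"
    using qbinomial_sum_tendsto[where c = 1 and w = w, OF assms theta_exp(2)[OF assms le0]]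
    by (simp only:)
  moreover have "((\<lambda>N. 2 * (qpoch (fps_X ^ a) N)\<^sup>2 * euler_prod a) \<longlongrightarrow> 2 * (euler_prod a)\<^sup>2 * euler_prod a) sequentially"
    unfolding power2_eq_square by (intro tendsto_fps_mult tendsto_const qpoch_tendsto assms)
  ultimately have "gf UNIV w (theta_exp a 0) = 2 * (euler_prod a)\<^sup>2 * euler_prod a"
    by (rule LIMSEQ_unique)
  thus ?thesis by (simp add: w_def power3_eq_cube power2_eq_square mult.assoc)
qed

lemma qpoch_split_2:
  "(\<Prod>i<N. 1 - fps_X ^ (2 * i + 1)) * qpoch (fps_X ^ 2) N = qpoch (fps_X ^ 1 :: int fps) (2 * N)"
  by (induction N) (simp_all add: qpoch_Suc mult_ac flip: power_mult power_Suc)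

lemma qpoch_split_3:
  "(\<Prod>i<N. 1 - fps_X ^ (6 * Suc i - 2)) * (\<Prod>i<N. 1 - fps_X ^ (6 * i + 2)) * qpoch (fps_X ^ 6) N
   = qpoch (fps_X ^ 2 :: int fps) (3 * N)"
proof (induction N)
  case (Suc N)
  have "3 * Suc N = Suc (Suc (Suc (3 * N)))" by simp
  have "qpoch (fps_X ^ 2 :: int fps) (3 * Suc N) = qpoch (fps_X ^ 2) (3 * N) *
      (1 - fps_X ^ (6 * N + 2)) * (1 - fps_X ^ (6 * Suc N - 2)) * (1 - fps_X ^ (6 * Suc N))"
  proof -
    have "2 * Suc (3 * N) = 6 * N + 2" "2 * Suc (Suc (3 * N)) = 6 * Suc N - 2"
      "2 * Suc (Suc (Suc (3 * N))) = 6 * Suc N" by simp_all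
    thus ?thesis unfolding \<open>3 * Suc N = _\<close> qpoch_Suc power_mult[symmetric] by (simp only:)
  qed
  thus ?case
    unfolding Suc.IH[symmetric]
    by (simp only: qpoch_Suc prod.lessThan_Suc power_mult[symmetric] mult_ac)
qed simp

lemma qpoch_subseq_tendsto:
  "a > 0 \<Longrightarrow> c > 0 \<Longrightarrow> ((\<lambda>N. qpoch (fps_X ^ a) (c * N)) \<longlongrightarrow> euler_prod a) sequentially"
  by (rule filterlim_compose[OF qpoch_tendsto mult_nat_left_at_top])

text \<open>The triple product with \<open>a = 2\<close>, \<open>b = 1\<close> is \<open>f\<^sub>2\<close> times the square of the product over odd exponents, and
  that product is \<open>f\<^sub>1 / f\<^sub>2\<close>. Multiplying by \<open>f\<^sub>2\<^sup>2\<close> keeps everything free of division.\<close>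

lemma gauss_square: "(euler_prod 1)\<^sup>2 = euler_prod 2 * gf UNIV parity_sign (theta_exp 2 1)"
proof -
  let ?P = "\<lambda>N. (\<Prod>i<N. 1 - fps_X ^ (2 * Suc i - 1)) * (\<Prod>i<N. 1 - fps_X ^ (2 * i + 1)) * euler_prod 2"
  have "((\<lambda>N. ?P N * (qpoch (fps_X ^ 2) N * qpoch (fps_X ^ 2) N)) \<longlongrightarrow>
           gf UNIV parity_sign (theta_exp 2 1) * (euler_prod 2 * euler_prod 2)) sequentially"
    by (intro tendsto_fps_mult jacobi_triple_limit qpoch_tendsto) auto
  moreover have "?P N * (qpoch (fps_X ^ 2) N * qpoch (fps_X ^ 2) N) =
      qpoch (fps_X ^ 1) (2 * N) * qpoch (fps_X ^ 1) (2 * N) * euler_prod 2" for N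
    unfolding qpoch_split_2[symmetric] by (simp add: mult_ac)
  moreover have "((\<lambda>N. qpoch (fps_X ^ 1) (2 * N) * qpoch (fps_X ^ 1) (2 * N) * euler_prod 2) \<longlongrightarrow>
      euler_prod 1 * euler_prod 1 * euler_prod 2) sequentially"
    by (intro tendsto_fps_mult qpoch_subseq_tendsto tendsto_const) auto
  ultimately have "gf UNIV parity_sign (theta_exp 2 1) * (euler_prod 2 * euler_prod 2) = euler_prod 1 * euler_prod 1 * euler_prod 2"
    using LIMSEQ_unique by (simp only:) blast
  thus ?thesis by (simp add: power2_eq_square mult_ac)
qed

text \<open>The factors with exponents 2, 4 and 0 modulo 6 together make up all even exponents.\<close>

lemma euler_pentagonal: "euler_prod 2 = gf UNIV parity_sign (theta_exp 6 2)"
proof -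
  let ?P = "\<lambda>N. (\<Prod>i<N. 1 - fps_X ^ (6 * Suc i - 2)) * (\<Prod>i<N. 1 - fps_X ^ (6 * i + 2)) * euler_prod 6"
  have "((\<lambda>N. ?P N * qpoch (fps_X ^ 6) N) \<longlongrightarrow> gf UNIV parity_sign (theta_exp 6 2) * euler_prod 6) sequentially"
    by (intro tendsto_fps_mult jacobi_triple_limit qpoch_tendsto) auto
  moreover have "?P N * qpoch (fps_X ^ 6) N = qpoch (fps_X ^ 2) (3 * N) * euler_prod 6" for N
    unfolding qpoch_split_3[symmetric] by (simp only: mult_ac)
  moreover have "((\<lambda>N. qpoch (fps_X ^ 2) (3 * N) * euler_prod 6) \<longlongrightarrow> euler_prod 2 * euler_prod 6) sequentially"
    by (intro tendsto_fps_mult qpoch_subseq_tendsto tendsto_const) auto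
  ultimately have "gf UNIV parity_sign (theta_exp 6 2) * euler_prod 6 = euler_prod 2 * euler_prod 6"
    using LIMSEQ_unique by (simp only:) blast
  thus ?thesis by simp
qed

section \<open>A factorisation of the fifth power of the Euler product\<close>

text \<open>The reflection \<open>k \<mapsto> 1 - k\<close> keeps \<open>k (k - 1) / 2\<close> and changes the sign.\<close>

lemma theta_sign_eq_0: "gf UNIV parity_sign (theta_exp 1 0) = 0"
proof (rule gf_involution_eq_0)
  show "bij_betw (\<lambda>k. 1 - k) UNIV (UNIV :: int set)"
    by (rule bij_betw_byWitness[where f' = "\<lambda>k. 1 - k"]) auto
  show "theta_exp 1 0 (1 - k) = theta_exp 1 0 k" for k
    using two_tri[of k] two_tri[of "1 - k"] by (simp add: theta_exp_def algebra_simps)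
qed (auto simp: parity_sign_def)

lemma XD_mult: "fps_XD (a * b) = a * fps_XD b + fps_XD a * (b :: int fps)"
  by (simp add: fps_XD_def algebra_simps)

text \<open>Jacobi's series times Gauss's series is a sum over pairs \<open>(k, m)\<close>. Put \<open>k = l + 2 m\<close>. The
  weight \<open>1 - 2 k\<close> may then be replaced by \<open>1 - 2 l\<close>, because the difference contains a factor
  that vanishes by \<open>theta_sign_eq_0\<close>. In the new coordinates the exponent is
  \<open>l (l - 1) / 2 + (2 l - 1) m + 3 m\<^sup>2\<close>. If \<open>2 l - 1\<close> is divisible by 3, that is \<open>l = 2\<close> modulo 3,
  the reflection of \<open>m\<close> about the minimum of this quadratic cancels the terms in pairs. In each of the
  other two classes a shift of \<open>m\<close> decouples \<open>l\<close> from \<open>m\<close>, and the sum over \<open>m\<close> becomes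
  the pentagonal series of \<open>f\<^sub>2\<close>. This is the Carlitz--Subbarao argument for the quintuple product,
  carried out on the derivative at \<open>z = 1\<close>.\<close>

lemma euler_prod_cube_mult_square_theta:
  "(euler_prod 1) ^ 3 * gf UNIV parity_sign (theta_exp 2 1) = gf UNIV (\<lambda>j. 1 - 6 * j) (theta_exp 3 1) * euler_prod 2"
proof -
  let ?U = "UNIV :: int set"
  let ?V = "UNIV :: (int \<times> int) set"
  define e where "e = (\<lambda>(k, m). theta_exp 1 0 k + theta_exp 2 1 m)"
  define e' where "e' = (\<lambda>(l, m). e (l + 2 * m, m))"
  have bij: "bij_betw (\<lambda>(l, m). (l + 2 * m, m)) ?V ?V"
    by (rule bij_betw_byWitness[where f' = "\<lambda>(k, m). (k - 2 * m, m)"]) auto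
  have fin: "finite_fibres ?U (theta_exp a b)" if "0 < a" "b \<le> a" for a b
    by (rule finite_fibres_linear_growth) (use theta_exp(2)[OF that] in auto)
  have prod: "gf ?U w (theta_exp 1 0) * gf ?U v (theta_exp 2 1) = gf ?V (\<lambda>(k, m). w k * v m) e" for w v
    using gf_mult[OF fin[of 1 0] fin[of 2 1], of w v] by (simp add: e_def)
  have ee': "int (e' (l, m)) = int (tri l) + (2 * l - 1) * m + 3 * m\<^sup>2" for l m
    using two_tri[of "l + 2 * m"] two_tri[of l] two_tri[of m]
    by (simp add: e'_def e_def theta_exp algebra_simps power2_eq_square)
  have fine': "finite_fibres ?V e'"
  proof -
    have "finite_fibres (?U \<times> ?U) e"
      unfolding e_def by (intro finite_fibres_times fin) auto
    hence fe: "finite {x. e x = n}" for n by (simp add: finite_fibres_def)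
    show ?thesis unfolding finite_fibres_def
    proof
      fix n
      have "{x \<in> ?V. e' x = n} = (\<lambda>(l, m). (l + 2 * m, m)) -` {x. e x = n}"
        by (auto simp: e'_def)
      also have "finite \<dots>"
        using bij by (intro finite_vimageI fe) (auto simp: bij_betw_def)
      finally show "finite {x \<in> ?V. e' x = n}" .
    qed
  qed
  define W where "W = (\<lambda>(l, m). parity_sign l * (1 - 2 * l) * parity_sign m)"
  have "2 * (euler_prod 1) ^ 3 * gf UNIV parity_sign (theta_exp 2 1) = 
       gf ?V (\<lambda>(k, m). parity_sign k * (1 - 2 * k) * parity_sign m) e + gf ?V (\<lambda>(k, m). parity_sign k * (4 * m * parity_sign m)) e"
    using prod[of parity_sign "\<lambda>m. 4 * m * parity_sign m"] prod[of "\<lambda>k. parity_sign k * (1 - 2 * k)" parity_sign]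
      theta_sign_eq_0 jacobi_cube[of 1] by simp
  also have "\<dots> = gf ?V W e'"
    unfolding gf_add[symmetric]
    by (rule gf_reindex[symmetric, OF bij]) (auto simp: W_def e'_def parity_sign_def algebra_simps)
  also have "\<dots> = gf ?V (\<lambda>(j, m). (1 - 6 * j) * parity_sign m) (\<lambda>(j, m). theta_exp 3 1 j + theta_exp 6 2 m)
     + gf ?V (\<lambda>(j, m). (1 - 6 * j) * parity_sign m) (\<lambda>(j, m). theta_exp 3 1 j + theta_exp 6 2 m)"
     (is "_ = ?R + _")
  proof -
    define I where "I = (\<lambda>r::int. {(l, m::int). l mod 3 = r})"
    have V: "?V = (I 0 \<union> I 1) \<union> I 2" by (auto simp: I_def)
    have dis: "(I 0 \<union> I 1) \<inter> I 2 = {}" "I 0 \<inter> I 1 = {}" by (auto simp: I_def)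
    have "finite_fibres (I 0 \<union> I 1) e'"
      using fine' by (auto simp: finite_fibres_def intro: finite_subset[rotated])
    hence "gf ?V W e' = gf (I 0) W e' + gf (I 1) W e' + gf (I 2) W e'"
      using gf_Un_disjoint[OF fine'[unfolded V] dis(1)] gf_Un_disjoint[OF _ dis(2)] by (simp add: V)
    moreover have "gf (I 2) W e' = 0"
    proof (rule gf_involution_eq_0)
      \<comment> \<open>The exponent is quadratic in \<open>m\<close> with axis of symmetry \<open>m = - (2 l - 1) / 6\<close>.\<close>
      let ?h = "\<lambda>(l, m). (l, - m - (2 * l - 1) div 3)"
      show "bij_betw ?h (I 2) (I 2)"
        by (rule bij_betw_byWitness[where f' = ?h]) (auto simp: I_def)
      fix x assume "x \<in> I 2"
      obtain j m where x: "x = (3 * j + 2, m)"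
      proof -
        obtain l m where x: "x = (l, m)" by (cases x)
        have "l = 3 * (l div 3) + 2" using \<open>x \<in> I 2\<close> mult_div_mod_eq[of 3 l] unfolding x I_def by simp
        thus ?thesis using that x by blast
      qed
      have d: "(2 * (3 * j + 2) - 1) div 3 = 2 * j + 1" by simp
      show "W (?h x) = - W x" by (simp add: x d W_def parity_sign_def)
      have "int (e' (?h x)) = int (e' x)"
        unfolding x prod.case d ee' by (simp add: algebra_simps power2_eq_square)
      thus "e' (?h x) = e' x" by simp
    qed
    moreover have "?R = gf (I 0) W e'"
    proof (rule gf_reindex)
      \<comment> \<open>The shift by \<open>j\<close> removes the mixed term \<open>6 j m\<close> from the exponent.\<close>
      show "bij_betw (\<lambda>(j, m). (3 * j, m - j)) UNIV (I 0)"
        by (rule bij_betw_byWitness[where f' = "\<lambda>(l, m). (l div 3, m + l div 3)"]) (auto simp: I_def)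
      fix x :: "int \<times> int"
      obtain j m where x: "x = (j, m)" by (cases x)
      show "(case x of (j, m) \<Rightarrow> (1 - 6 * j) * parity_sign m) = W (case x of (j, m) \<Rightarrow> (3 * j, m - j))"
        by (auto simp: x W_def parity_sign_def)
      have "int (theta_exp 3 1 j + theta_exp 6 2 m) = int (e' (3 * j, m - j))"
        using two_tri[of "3 * j"] two_tri[of j] two_tri[of m] unfolding of_nat_add ee'
        by (simp add: theta_exp algebra_simps power2_eq_square)
      thus "(case x of (j, m) \<Rightarrow> theta_exp 3 1 j + theta_exp 6 2 m) = e' (case x of (j, m) \<Rightarrow> (3 * j, m - j))"
        by (simp add: x)
    qed
    moreover have "?R = gf (I 1) W e'"
    proof (rule gf_reindex)
      \<comment> \<open>Negating \<open>j\<close> and \<open>m\<close> as well gives the same exponents and weights as in the class of 0.\<close>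
      show "bij_betw (\<lambda>(j, m). (1 - 3 * j, j - m)) UNIV (I 1)"
      proof (rule bij_betw_byWitness[where f' = "\<lambda>(l, m). (- (l div 3), - (l div 3) - m)"])
        show "\<forall>x\<in>(UNIV :: (int \<times> int) set). (case case x of (j, m) \<Rightarrow> (1 - 3 * j, j - m) of (l, m) \<Rightarrow> (- (l div 3), - (l div 3) - m)) = x"
          by auto
        show "\<forall>x\<in>I 1. (case case x of (l, m) \<Rightarrow> (- (l div 3), - (l div 3) - m) of (j, m) \<Rightarrow> (1 - 3 * j, j - m)) = x"
          by (auto simp: I_def) presburger
        show "range (\<lambda>(j, m). (1 - 3 * j, j - m)) \<subseteq> I 1" by (auto simp: I_def) presburger
      qed auto
      fix x :: "int \<times> int"
      obtain j m where x: "x = (j, m)" by (cases x)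
      show "(case x of (j, m) \<Rightarrow> (1 - 6 * j) * parity_sign m) = W (case x of (j, m) \<Rightarrow> (1 - 3 * j, j - m))"
        by (auto simp: x W_def parity_sign_def)
      have "int (theta_exp 3 1 j + theta_exp 6 2 m) = int (e' (1 - 3 * j, j - m))"
        using two_tri[of "1 - 3 * j"] two_tri[of j] two_tri[of m] unfolding of_nat_add ee'
        by (simp add: theta_exp algebra_simps power2_eq_square)
      thus "(case x of (j, m) \<Rightarrow> theta_exp 3 1 j + theta_exp 6 2 m) = e' (case x of (j, m) \<Rightarrow> (1 - 3 * j, j - m))"
        by (simp add: x)
    qed
    ultimately show ?thesis by simp
  qed
  also have "?R = gf UNIV (\<lambda>j. 1 - 6 * j) (theta_exp 3 1) * euler_prod 2"
    using gf_mult[OF fin[of 3 1] fin[of 6 2], of "\<lambda>j. 1 - 6 * j" parity_sign] by (simp add: euler_pentagonal)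
  finally show ?thesis by simp
qed

text \<open>One factor \<open>f\<^sub>1\<^sup>2\<close> is replaced by \<open>f\<^sub>2\<close> times Gauss's series.\<close>

lemma euler_prod_power_5: "euler_prod 1 ^ 5 = gf UNIV (\<lambda>j. 1 - 6 * j) (theta_exp 3 1) * (euler_prod 2)\<^sup>2"
proof -
  have "euler_prod 1 ^ 5 = euler_prod 1 ^ 3 * (euler_prod 1)\<^sup>2"
    by (simp flip: power_add)
  also have "\<dots> = (euler_prod 1 ^ 3 * gf UNIV parity_sign (theta_exp 2 1)) * euler_prod 2"
    by (simp only: gauss_square mult_ac)
  also have "\<dots> = gf UNIV (\<lambda>j. 1 - 6 * j) (theta_exp 3 1) * (euler_prod 2)\<^sup>2"
    by (simp only: euler_prod_cube_mult_square_theta power2_eq_square mult_ac)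
  finally show ?thesis .
qed

section \<open>Divisibility by 7\<close>

text \<open>With \<open>x = 6 j - 1\<close> and \<open>y = 2 k - 1\<close> the assumption implies \<open>x\<^sup>2 = 1 + y\<^sup>2\<close> modulo 7. As 3 and 5 are not
  squares modulo 7, this leaves \<open>y\<^sup>2 = 0\<close> or \<open>y\<^sup>2 = 1\<close>, and the conclusion concerns
  \<open>y (y\<^sup>2 - 1)\<close> up to the factor \<open>-4\<close>. There are only 49 residue pairs to check.\<close>

lemma seven_dvd_weight:
  fixes j k n :: int
  assumes "3 * j * j - j + 2 * k * k - 2 * k = 14 * n + 10"
  shows "7 dvd (1 - 2 * k) * (k * (k - 1))"
proof -
  have "(3 * j * j - j + 2 * k * k - 2 * k) mod 7 = (14 * n + 10) mod 7" using assms by simp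
  also have "(14 * n + 10) mod 7 = (3::int)" by presburger
  finally have *: "(3 * j * j - j + 2 * k * k - 2 * k) mod 7 = 3" .
  have cong: "[j mod 7 = j] (mod 7)" "[k mod 7 = k] (mod 7)" by (simp_all add: cong_def)
  have "[3 * (j mod 7) * (j mod 7) - j mod 7 + 2 * (k mod 7) * (k mod 7) - 2 * (k mod 7)
         = 3 * j * j - j + 2 * k * k - 2 * k] (mod 7)"
    by (intro cong_add cong_diff cong_mult cong_refl cong)
  with * have **: "(3 * (j mod 7) * (j mod 7) - j mod 7 + 2 * (k mod 7) * (k mod 7) - 2 * (k mod 7)) mod 7 = 3"
    by (simp only: cong_def)
  have "j mod 7 \<in> {0..6}" "k mod 7 \<in> {0..6}" by auto
  moreover have "{0..6} = {0, 1, 2, 3, 4, 5, 6 :: int}" by auto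
  ultimately have "((1 - 2 * (k mod 7)) * ((k mod 7) * ((k mod 7) - 1))) mod 7 = 0"
    using ** by auto
  moreover have "[(1 - 2 * (k mod 7)) * ((k mod 7) * ((k mod 7) - 1)) = (1 - 2 * k) * (k * (k - 1))] (mod 7)"
    by (intro cong_diff cong_mult cong_refl cong)
  ultimately have "((1 - 2 * k) * (k * (k - 1))) mod 7 = 0"
    by (simp only: cong_def)
  thus ?thesis by (rule mod_0_imp_dvd)
qed

text \<open>The factor 6 makes \<open>f\<^sub>2\<^sup>2 D f\<^sub>2\<close> the derivative of \<open>2 f\<^sub>2\<^sup>3\<close>, and it is invertible modulo 7. Afterwards
  every term of the double series is divisible by 7.\<close>

lemma seven_dvd_euler_prod_XD: "7 dvd (euler_prod 1 ^ 5 * fps_XD (euler_prod 2)) $ (7 * n + 5)"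
proof -
  define A where "A = gf UNIV (\<lambda>j. 1 - 6 * j) (theta_exp 3 1)"
  define v where "v = (\<lambda>k. int (theta_exp 2 0 k) * (parity_sign k * (1 - 2 * k)))"
  have fin: "finite_fibres (UNIV :: int set) (theta_exp a b)" if "0 < a" "b \<le> a" for a b
    by (rule finite_fibres_linear_growth) (use theta_exp(2)[OF that] in auto)
  have "6 * ((euler_prod 2)\<^sup>2 * fps_XD (euler_prod 2)) = fps_XD (2 * euler_prod 2 ^ 3)"
    by (simp add: fps_XD_def fps_deriv_power' power2_eq_square power3_eq_cube)
  also have "\<dots> = gf UNIV v (theta_exp 2 0)"
    by (simp add: jacobi_cube XD_gf v_def)
  finally have "6 * (euler_prod 1 ^ 5 * fps_XD (euler_prod 2)) = A * gf UNIV v (theta_exp 2 0)"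
    unfolding euler_prod_power_5 A_def[symmetric] by (simp add: mult_ac)
  also have "\<dots> = gf (UNIV \<times> UNIV) (\<lambda>(j, k). (1 - 6 * j) * v k) (\<lambda>(j, k). theta_exp 3 1 j + theta_exp 2 0 k)"
    unfolding A_def by (rule gf_mult) (auto intro!: fin)
  also have "7 dvd \<dots> $ (7 * n + 5)"
    unfolding gf_nth
  proof (rule dvd_sum)
    fix x :: "int \<times> int"
    assume *: "x \<in> {x \<in> UNIV \<times> UNIV. (case x of (j, k) \<Rightarrow> theta_exp 3 1 j + theta_exp 2 0 k) = 7 * n + 5}"
    obtain j k where x: "x = (j, k)" by (cases x)
    have "int (theta_exp 3 1 j) + int (theta_exp 2 0 k) = 7 * int n + 5"
      using * unfolding x by (simp flip: of_nat_add)
    hence "3 * j * j - j + 2 * k * k - 2 * k = 14 * int n + 10"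
      using two_tri[of j] two_tri[of k] by (simp add: theta_exp algebra_simps)
    from seven_dvd_weight[OF this] have dvd: "7 dvd (1 - 2 * k) * (k * (k - 1))" .
    have eq: "(1 - 6 * j) * v k = (1 - 6 * j) * parity_sign k * ((1 - 2 * k) * (k * (k - 1)))"
      using two_tri[of k] by (simp add: v_def theta_exp_0)
    show "7 dvd (case x of (j, k) \<Rightarrow> (1 - 6 * j) * v k)"
      unfolding x prod.case eq by (rule dvd_mult[OF dvd])
  qed
  finally have "7 dvd 6 * (euler_prod 1 ^ 5 * fps_XD (euler_prod 2)) $ (7 * n + 5)"
    by (metis of_int_mult_nth of_int_numeral)
  thus ?thesis
    by presburger
qed

text \<open>Compare coefficients in \<open>D (F^p) = p F^(p-1) D F\<close>.\<close>

lemma prime_dvd_nth_power: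
  fixes F :: "int fps"
  assumes "prime p" "\<not> p dvd n"
  shows "int p dvd (F ^ p) $ n"
proof -
  have "p > 0" using assms(1) by (simp add: prime_gt_0_nat)
  have "fps_XD (F ^ p) = of_nat p * (F ^ (p - 1) * fps_XD F)"
    by (simp add: fps_XD_def fps_deriv_power' mult_ac)
  hence "int n * (F ^ p) $ n = int p * (F ^ (p - 1) * fps_XD F) $ n"
    by (metis fps_XD_nth of_int_mult_nth of_int_of_nat_eq)
  hence "int p dvd int n * (F ^ p) $ n" by simp
  thus ?thesis using assms by (simp add: prime_dvd_mult_iff)
qed

text \<open>Modulo \<open>p\<close> the series \<open>F^p\<close> is a series in \<open>X^p\<close> with constant term 1, so multiplication by it acts
  separately on each residue class of exponents and can be undone there.\<close>

lemma dvd_nth_if_dvd_nth_power_mult: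
  fixes F G :: "int fps"
  assumes "prime p" "r < p" "F $ 0 = 1" "\<And>n. int p dvd (F ^ p * G) $ (p * n + r)"
  shows "int p dvd G $ (p * n + r)"
proof (induction n rule: less_induct)
  case (less n)
  let ?m = "p * n + r"
  have p: "p > 0" using assms(1) by (simp add: prime_gt_0_nat)
  have eq: "(F ^ p * G) $ ?m = G $ ?m + (\<Sum>i\<in>{0<..?m}. (F ^ p) $ i * G $ (?m - i))"
  proof -
    have "{0..?m} = insert 0 {0<..?m}" by auto
    thus ?thesis by (simp add: fps_mult_nth assms(3) fps_nth_power_0)
  qed
  have dvd: "int p dvd (\<Sum>i\<in>{0<..?m}. (F ^ p) $ i * G $ (?m - i))"
  proof (rule dvd_sum)
    fix i assume i: "i \<in> {0<..?m}"
    show "int p dvd (F ^ p) $ i * G $ (?m - i)"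
    proof (cases "p dvd i")
      case False
      thus ?thesis using prime_dvd_nth_power[OF assms(1)] by simp
    next
      case True
      then obtain t where t: "i = p * t" by blast
      have "p * t < p * Suc n" using i assms(2) by (simp add: t)
      hence "t < Suc n" by (simp only: mult_less_cancel1)
      hence "t \<le> n" "0 < t" using i by (auto simp: t)
      hence "?m - i = p * (n - t) + r" by (simp add: t diff_mult_distrib2)
      thus ?thesis using less.IH[of "n - t"] \<open>0 < t\<close> \<open>t \<le> n\<close> by simp
    qed
  qed
  show ?case
    using assms(4)[of n] unfolding eq dvd_add_left_iff[OF dvd] .
qed

section \<open>The generating function of SENO\<close>

definition msets_on :: "nat set \<Rightarrow> nat multiset set" where
  "msets_on s = {A. set_mset A \<subseteq> s}"

definition fsets_on :: "nat set \<Rightarrow> nat set set" where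
  "fsets_on s = {S. finite S \<and> S \<subseteq> s}"

definition even_sum :: "nat multiset \<Rightarrow> int" where
  "even_sum A = int (\<Sum>\<^sub># (filter_mset even A))"

lemma finite_fibres_msets_on: "0 \<notin> s \<Longrightarrow> finite_fibres (msets_on s) sum_mset"
  unfolding finite_fibres_def
proof
  fix n assume s: "0 \<notin> s"
  have "{A \<in> msets_on s. \<Sum>\<^sub># A = n} \<subseteq> mset ` {xs. set xs \<subseteq> {..n} \<and> length xs \<le> n}"
  proof
    fix A assume A: "A \<in> {A \<in> msets_on s. \<Sum>\<^sub># A = n}"
    obtain xs where xs: "A = mset xs" by (metis ex_mset)
    have pos: "0 \<notin> set xs" and n: "sum_list xs = n"
      using A s by (auto simp: xs msets_on_def sum_mset_sum_list)
    have "length xs \<le> sum_list xs"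
      using pos by (induction xs) auto
    moreover have "x \<le> n" if "x \<in> set xs" for x
      using member_le_sum_list[OF that] n by simp
    ultimately show "A \<in> mset ` {xs. set xs \<subseteq> {..n} \<and> length xs \<le> n}"
      using n xs by auto
  qed
  thus "finite {A \<in> msets_on s. \<Sum>\<^sub># A = n}"
    by (rule finite_subset) (intro finite_imageI finite_lists_length_le, simp)
qed

lemma finite_fibres_fsets_on: "finite_fibres (fsets_on s) \<Sum>"
  unfolding finite_fibres_def
proof
  fix n
  have "{S \<in> fsets_on s. \<Sum>S = n} \<subseteq> Pow {..n}"
    by (auto simp: fsets_on_def intro: member_le_sum[of _ _ "\<lambda>x. x"])
  thus "finite {S \<in> fsets_on s. \<Sum>S = n}" by (rule finite_subset) simp
qed

context
  fixes m :: nat and s :: "nat set"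
  assumes m: "m \<notin> s" "m > 0" and s: "0 \<notin> s"
begin

text \<open>Either \<open>m\<close> does not occur, or one copy of it can be removed. Removing a single copy, instead of all
  of them, yields a linear equation for the series that involves only \<open>X^m\<close>.\<close>

lemma gf_msets_on_insert:
  "gf (msets_on (insert m s)) w sum_mset =
   gf (msets_on s) w sum_mset + fps_X ^ m * gf (msets_on (insert m s)) (\<lambda>A. w (add_mset m A)) sum_mset"
proof -
  have U: "msets_on (insert m s) = msets_on s \<union> add_mset m ` msets_on (insert m s)"
  proof (intro equalityI subsetI)
    fix A assume A: "A \<in> msets_on (insert m s)"
    show "A \<in> msets_on s \<union> add_mset m ` msets_on (insert m s)"
    proof (cases "m \<in># A")
      case True
      then obtain B where "A = add_mset m B" by (metis multi_member_split)
      thus ?thesis using A by (auto simp: msets_on_def)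
    qed (use A in \<open>auto simp: msets_on_def\<close>)
  qed (auto simp: msets_on_def)
  have fin: "finite_fibres (msets_on (insert m s)) sum_mset"
    using m s by (intro finite_fibres_msets_on) auto
  have "gf (msets_on (insert m s)) w sum_mset =
        gf (msets_on s) w sum_mset + gf (add_mset m ` msets_on (insert m s)) w sum_mset"
  proof -
    have "msets_on s \<inter> add_mset m ` msets_on (insert m s) = {}"
      using m by (auto simp: msets_on_def)
    from gf_Un_disjoint[OF _ this, of sum_mset w] fin show ?thesis
      unfolding U[symmetric] by blast
  qed
  also have "gf (add_mset m ` msets_on (insert m s)) w sum_mset =
             fps_X ^ m * gf (msets_on (insert m s)) (\<lambda>A. w (add_mset m A)) sum_mset"
    by (rule gf_shift) (auto simp: bij_betw_def inj_on_def)
  finally show ?thesis .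
qed

lemma gf_fsets_on_insert:
  "gf (fsets_on (insert m s)) (\<lambda>_. 1) \<Sum> = (1 + fps_X ^ m) * gf (fsets_on s) (\<lambda>_. 1) \<Sum>"
proof -
  have U: "fsets_on (insert m s) = fsets_on s \<union> insert m ` fsets_on s"
  proof (intro equalityI subsetI)
    fix S assume S: "S \<in> fsets_on (insert m s)"
    show "S \<in> fsets_on s \<union> insert m ` fsets_on s"
    proof (cases "m \<in> S")
      case True
      hence "S = insert m (S - {m})" by auto
      moreover have "S - {m} \<in> fsets_on s" using S by (auto simp: fsets_on_def)
      ultimately show ?thesis by blast
    qed (use S in \<open>auto simp: fsets_on_def\<close>)
  qed (auto simp: fsets_on_def)
  have "gf (fsets_on (insert m s)) (\<lambda>_. 1) \<Sum> =
        gf (fsets_on s) (\<lambda>_. 1) \<Sum> + gf (insert m ` fsets_on s) (\<lambda>_. 1) \<Sum>"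
    using gf_Un_disjoint[OF finite_fibres_fsets_on[of "insert m s", unfolded U]] m
    by (subst U) (auto simp: fsets_on_def)
  also have "gf (insert m ` fsets_on s) (\<lambda>_. 1) \<Sum> = fps_X ^ m * gf (fsets_on s) (\<lambda>_. 1) \<Sum>"
  proof (rule gf_shift)
    show "bij_betw (insert m) (fsets_on s) (insert m ` fsets_on s)"
      using m by (auto simp: bij_betw_def inj_on_def fsets_on_def)
    show "\<Sum>(insert m S) = \<Sum>S + m" if "S \<in> fsets_on s" for S
      using m that by (subst sum.insert) (auto simp: fsets_on_def)
  qed
  finally show ?thesis by (simp add: algebra_simps)
qed

end

lemma partition_gf:
  assumes "finite s" "0 \<notin> s"
  shows "gf (msets_on s) (\<lambda>_. 1) sum_mset * (\<Prod>i\<in>s. 1 - fps_X ^ i) = 1"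
  using assms
proof (induction s rule: finite_induct)
  case empty
  have "{A \<in> msets_on {}. \<Sum>\<^sub># A = n} = (if n = 0 then {{#}} else {})" for n
    by (auto simp: msets_on_def)
  thus ?case by (intro fps_ext) (simp add: gf_nth)
next
  case (insert m s)
  let ?G = "\<lambda>s. gf (msets_on s) (\<lambda>_. 1) sum_mset"
  have "?G (insert m s) * (1 - fps_X ^ m) = ?G s"
    using gf_msets_on_insert[of m s "\<lambda>_. 1"] insert by (simp add: algebra_simps)
  thus ?case using insert by (simp add: mult.assoc[symmetric])
qed

lemma distinct_partition_gf:
  assumes "finite s" "0 \<notin> s"
  shows "gf (fsets_on s) (\<lambda>_. 1) \<Sum> = (\<Prod>i\<in>s. 1 + fps_X ^ i)"
  using assms
proof (induction s rule: finite_induct)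
  case empty
  have "{S \<in> fsets_on {}. \<Sum>S = n} = (if n = 0 then {{}} else {})" for n
    by (auto simp: fsets_on_def)
  thus ?case by (intro fps_ext) (simp add: gf_nth)
qed (use gf_fsets_on_insert in auto)

text \<open>Inserting an even part \<open>m\<close> changes the weight by \<open>m\<close> for each copy; on the other side this is
  the contribution of the new factor \<open>1 - X^m\<close> to the derivative of the product. In quotient form,
  the weighted series is the partition series times minus the logarithmic derivative of the
  product over even parts.\<close>

lemma even_sum_gf:
  assumes "finite s" "0 \<notin> s"
  shows "gf (msets_on s) even_sum sum_mset * (\<Prod>i\<in>{i \<in> s. even i}. 1 - fps_X ^ i) =
         - (gf (msets_on s) (\<lambda>_. 1) sum_mset * fps_XD (\<Prod>i\<in>{i \<in> s. even i}. 1 - fps_X ^ i))"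
  using assms
proof (induction s rule: finite_induct)
  case empty
  have "gf (msets_on {}) even_sum sum_mset = 0"
    by (rule fps_ext) (auto simp: gf_nth msets_on_def even_sum_def intro!: sum.neutral)
  thus ?case by (simp add: fps_XD_def)
next
  case (insert m s)
  let ?G = "\<lambda>s. gf (msets_on s) (\<lambda>_. 1) sum_mset"
  let ?H = "\<lambda>s. gf (msets_on s) even_sum sum_mset"
  define E where "E = (\<Prod>i\<in>{i \<in> s. even i}. 1 - fps_X ^ i :: int fps)"
  have IH: "?H s * E = - (?G s * fps_XD E)"
    unfolding E_def using insert by auto
  have G: "?G s = ?G (insert m s) * (1 - fps_X ^ m)"
    using gf_msets_on_insert[of m s "\<lambda>_. 1"] insert by (simp add: algebra_simps)
  define c :: int where "c = (if even m then int m else 0)"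
  have "(\<lambda>A. even_sum (add_mset m A)) = (\<lambda>A. even_sum A + c * 1)"
    by (auto simp: even_sum_def c_def)
  hence H: "?H s = ?H (insert m s) * (1 - fps_X ^ m) - fps_X ^ m * of_int c * ?G (insert m s)"
    using gf_msets_on_insert[of m s even_sum] insert
    by (simp only: gf_add gf_cmult) (simp add: algebra_simps)
  show ?case
  proof (cases "even m")
    case True
    hence "{i \<in> insert m s. even i} = insert m {i \<in> s. even i}" by auto
    hence E: "(\<Prod>i\<in>{i \<in> insert m s. even i}. 1 - fps_X ^ i) = (1 - fps_X ^ m) * E"
      using insert by (simp add: E_def)
    have "fps_XD (1 - fps_X ^ m :: int fps) = - (of_int c * fps_X ^ m)"
      by (rule fps_ext) (use True in \<open>auto simp: c_def of_int_mult_nth\<close>)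
    hence D: "fps_XD ((1 - fps_X ^ m) * E) = (1 - fps_X ^ m) * fps_XD E - of_int c * fps_X ^ m * E"
      by (simp add: XD_mult)
    show ?thesis using IH unfolding E D G H by (simp add: algebra_simps)
  next
    case False
    hence "{i \<in> insert m s. even i} = {i \<in> s. even i}" by auto
    moreover have "(?H (insert m s) * E + ?G (insert m s) * fps_XD E) * (1 - fps_X ^ m) =
        ?H s * E + ?G s * fps_XD E"
      unfolding G H using False by (simp add: c_def algebra_simps)
    hence "(?H (insert m s) * E + ?G (insert m s) * fps_XD E) * (1 - fps_X ^ m) = 0"
      unfolding IH by simp
    moreover have "(1 - fps_X ^ m :: int fps) $ 0 = 1"
      using False by (auto simp: odd_pos)
    hence "1 - fps_X ^ m \<noteq> (0 :: int fps)"
      by (metis fps_zero_nth zero_neq_one)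
    ultimately show ?thesis by (simp add: E_def eq_neg_iff_add_eq_0)
  qed
qed

text \<open>A multiset with sum \<open>n\<close> only has parts up to \<open>n\<close>. The bound \<open>2 N\<close> makes the number of
  even parts exactly \<open>N\<close>.\<close>

lemma msets_on_tendsto:
  "((\<lambda>N. gf (msets_on {0<..2 * N}) w sum_mset) \<longlongrightarrow> gf (msets_on {0<..}) w sum_mset) sequentially"
proof (rule tendsto_fpsI)
  fix n
  show "eventually (\<lambda>N. gf (msets_on {0<..2 * N}) w sum_mset $ n = gf (msets_on {0<..}) w sum_mset $ n) sequentially"
    using eventually_ge_at_top[of n]
  proof eventually_elim
    case (elim N)
    have "x \<le> 2 * N" if "\<Sum>\<^sub># A = n" "x \<in># A" for A x
      using that elim by (auto dest!: multi_member_split)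
    hence "{A \<in> msets_on {0<..2 * N}. \<Sum>\<^sub># A = n} = {A \<in> msets_on {0<..}. \<Sum>\<^sub># A = n}"
      by (fastforce simp: msets_on_def)
    thus ?case by (simp add: gf_nth)
  qed
qed

lemma fsets_on_tendsto:
  "((\<lambda>N. gf (fsets_on {0<..2 * N}) w \<Sum>) \<longlongrightarrow> gf (fsets_on {0<..}) w \<Sum>) sequentially"
proof (rule tendsto_fpsI)
  fix n
  show "eventually (\<lambda>N. gf (fsets_on {0<..2 * N}) w \<Sum> $ n = gf (fsets_on {0<..}) w \<Sum> $ n) sequentially"
    using eventually_ge_at_top[of n]
  proof eventually_elim
    case (elim N)
    have "x \<le> 2 * N" if "\<Sum>A = n" "finite A" "x \<in> A" for A x
      using member_le_sum[of x A "\<lambda>x. x"] that elim by simp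
    hence "{A \<in> fsets_on {0<..2 * N}. \<Sum>A = n} = {A \<in> fsets_on {0<..}. \<Sum>A = n}"
      by (fastforce simp: fsets_on_def)
    thus ?case by (simp add: gf_nth)
  qed
qed

lemma qpoch_eq_prod: "qpoch q N = (\<Prod>i\<in>{0<..N}. 1 - q ^ i)"
  unfolding qpoch_def by (rule prod.reindex_bij_witness[of _ "\<lambda>i. i - 1" Suc]) auto

lemma partition_gf_limit: "gf (msets_on {0<..}) (\<lambda>_. 1) sum_mset * euler_prod 1 = 1"
proof -
  let ?G = "\<lambda>s. gf (msets_on s) (\<lambda>_. 1) sum_mset"
  have "((\<lambda>N. ?G {0<..2 * N} * qpoch (fps_X ^ 1) (2 * N)) \<longlongrightarrow> ?G {0<..} * euler_prod 1) sequentially"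
    by (intro tendsto_fps_mult msets_on_tendsto qpoch_subseq_tendsto) auto
  moreover have "?G {0<..2 * N} * qpoch (fps_X ^ 1) (2 * N) = 1" for N
    using partition_gf[of "{0<..2 * N}"] by (simp add: qpoch_eq_prod)
  ultimately have "((\<lambda>N. 1) \<longlongrightarrow> ?G {0<..} * euler_prod 1) sequentially" by (simp only:)
  from LIMSEQ_unique[OF this tendsto_const] show ?thesis .
qed

text \<open>Euler's observation \<open>(1 + X^i) (1 - X^i) = 1 - X^(2 i)\<close>.\<close>

lemma distinct_partition_gf_limit: "gf (fsets_on {0<..}) (\<lambda>_. 1) \<Sum> * euler_prod 1 = euler_prod 2"
proof -
  let ?S = "\<lambda>s. gf (fsets_on s) (\<lambda>_. 1) \<Sum>"
  have "((\<lambda>N. ?S {0<..2 * N} * qpoch (fps_X ^ 1) (2 * N)) \<longlongrightarrow> ?S {0<..} * euler_prod 1) sequentially"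
    by (intro tendsto_fps_mult fsets_on_tendsto qpoch_subseq_tendsto) auto
  moreover have "?S {0<..2 * N} * qpoch (fps_X ^ 1) (2 * N) = qpoch (fps_X ^ 2) (2 * N)" for N
  proof -
    have "(1 + x) * (1 - x) = 1 - x ^ 2" for x :: "int fps"
      by (simp add: algebra_simps power2_eq_square)
    thus ?thesis
      using distinct_partition_gf[of "{0<..2 * N}"]
      by (simp add: qpoch_eq_prod prod.distrib[symmetric] flip: power_mult) (simp add: mult.commute)
  qed
  ultimately have "((\<lambda>N. qpoch (fps_X ^ 2) (2 * N)) \<longlongrightarrow> ?S {0<..} * euler_prod 1) sequentially"
    by (simp only:)
  from LIMSEQ_unique[OF this qpoch_subseq_tendsto] show ?thesis by simp
qed

lemma even_sum_gf_limit:
  "gf (msets_on {0<..}) even_sum sum_mset * euler_prod 2 =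
   - gf (msets_on {0<..}) (\<lambda>_. 1) sum_mset * fps_XD (euler_prod 2)"
proof -
  let ?G = "\<lambda>s. gf (msets_on s) (\<lambda>_. 1) sum_mset"
  let ?H = "\<lambda>s. gf (msets_on s) even_sum sum_mset"
  have XD: "((\<lambda>N. fps_XD (qpoch (fps_X ^ 2) N)) \<longlongrightarrow> fps_XD (euler_prod 2)) sequentially"
    using qpoch_tendsto[of 2] unfolding tendsto_fps_iff by (auto elim: eventually_mono)
  have "((\<lambda>N. ?H {0<..2 * N} * qpoch (fps_X ^ 2) N + ?G {0<..2 * N} * fps_XD (qpoch (fps_X ^ 2) N))
     \<longlongrightarrow> ?H {0<..} * euler_prod 2 + ?G {0<..} * fps_XD (euler_prod 2)) sequentially"
    by (intro tendsto_fps_add tendsto_fps_mult msets_on_tendsto qpoch_tendsto XD) simp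
  moreover have "?H {0<..2 * N} * qpoch (fps_X ^ 2) N + ?G {0<..2 * N} * fps_XD (qpoch (fps_X ^ 2) N) = 0" for N
  proof -
    have "(\<Prod>i\<in>{i \<in> {0<..2 * N}. even i}. 1 - fps_X ^ i) = qpoch (fps_X ^ 2 :: int fps) N"
      unfolding qpoch_eq_prod by (rule prod.reindex_bij_witness[of _ "\<lambda>i. 2 * i" "\<lambda>i. i div 2"]) (auto simp flip: power_mult)
    thus ?thesis using even_sum_gf[of "{0<..2 * N}"] by simp
  qed
  ultimately have "((\<lambda>N. 0) \<longlongrightarrow> ?H {0<..} * euler_prod 2 + ?G {0<..} * fps_XD (euler_prod 2)) sequentially"
    by (simp only:)
  from LIMSEQ_unique[OF this tendsto_const] show ?thesis by (simp add: eq_neg_iff_add_eq_0)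
qed

text \<open>An overpartition is determined by its non-overlined parts and its set of overlined sizes; the
  underlying partition is recovered by sorting their union.\<close>

lemma SENO_eq:
  "int (SENO n) = (gf (msets_on {0<..}) even_sum sum_mset * gf (fsets_on {0<..}) (\<lambda>_. 1) \<Sum>) $ n"
proof -
  define T where "T = {x \<in> msets_on {0<..} \<times> fsets_on {0<..}. (case x of (A, S) \<Rightarrow> \<Sum>\<^sub># A + \<Sum>S) = n}"
  have sub: "mset_set S \<subseteq># mset xs" if "S \<subseteq> set xs" for S and xs :: "nat list"
  proof (rule mset_subset_eqI)
    fix x
    have "finite S" using that by (rule finite_subset) simp
    moreover have "x \<in> S \<Longrightarrow> 0 < count (mset xs) x" using that by auto
    ultimately show "count (mset_set S) x \<le> count (mset xs) x"
      by (cases "x \<in> S") (auto simp: Suc_le_eq)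
  qed
  have sum_set: "\<Sum>\<^sub># (mset_set S) = \<Sum>S" for S :: "nat set"
    by (simp add: sum_unfold_sum_mset)
  let ?f = "\<lambda>p :: nat list \<times> nat set. (nonoverlined_parts p, snd p)"
  let ?g = "\<lambda>(A, S). (rev (sorted_list_of_multiset (A + mset_set S)), S :: nat set)"
  have "int (SENO n) = (\<Sum>p\<in>overpartitions n. even_sum (nonoverlined_parts p))"
    by (simp add: SENO_def even_sum_def)
  also have "\<dots> = (\<Sum>(A, S)\<in>T. even_sum A * 1)"
  proof (rule sum.reindex_bij_witness[where j = ?f and i = ?g])
    fix p assume p: "p \<in> overpartitions n"
    obtain xs S where pxs: "p = (xs, S)" by (cases p)
    have xs: "sorted_wrt (\<ge>) xs" "0 \<notin> set xs" "sum_list xs = n" "S \<subseteq> set xs"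
      using p by (auto simp: pxs overpartitions_def partitions_def)
    have eq: "nonoverlined_parts p + mset_set S = mset xs"
      using sub[OF xs(4)] by (simp add: pxs nonoverlined_parts_def)
    have "sorted (rev xs)" using xs(1) by (simp add: sorted_wrt_rev)
    hence "sort xs = rev xs" by (intro properties_for_sort) auto
    thus "?g (?f p) = p" by (simp add: pxs eq[unfolded pxs])
    have "\<Sum>\<^sub># (nonoverlined_parts p) + \<Sum>S = n"
      using arg_cong[OF eq, of sum_mset] xs(3) by (simp add: sum_set sum_mset_sum_list)
    moreover have "set_mset (nonoverlined_parts p) \<subseteq> set xs"
      by (auto simp: pxs nonoverlined_parts_def dest: in_diffD)
    moreover have "finite S" using xs(4) by (rule finite_subset) simp
    ultimately show "?f p \<in> T"
      using xs(2,4) unfolding T_def pxs msets_on_def fsets_on_def by (auto intro!: gr0I)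
    show "(case ?f p of (A, S) \<Rightarrow> even_sum A * 1) = even_sum (nonoverlined_parts p)" by simp
  next
    fix x assume x: "x \<in> T"
    obtain A S where xAS: "x = (A, S)" by (cases x)
    have AS: "set_mset A \<subseteq> {0<..}" "finite S" "S \<subseteq> {0<..}" "\<Sum>\<^sub># A + \<Sum>S = n"
      using x by (auto simp: T_def xAS msets_on_def fsets_on_def)
    show "?f (?g x) = x" by (simp add: xAS nonoverlined_parts_def)
    have "sum_list (sorted_list_of_multiset (A + mset_set S)) = n"
      using AS(4) by (simp flip: sum_mset_sum_list add: sum_set)
    moreover have "sorted_wrt (\<ge>) (rev (sorted_list_of_multiset (A + mset_set S)))"
      by (simp add: sorted_wrt_rev)
    ultimately show "?g x \<in> overpartitions n"
      using AS by (auto simp: xAS overpartitions_def partitions_def)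
  qed
  also have "\<dots> = gf (msets_on {0<..} \<times> fsets_on {0<..}) (\<lambda>(A, S). even_sum A * 1) (\<lambda>(A, S). \<Sum>\<^sub># A + \<Sum>S) $ n"
    by (simp add: gf_nth T_def)
  also have "\<dots> = (gf (msets_on {0<..}) even_sum sum_mset * gf (fsets_on {0<..}) (\<lambda>_. 1) \<Sum>) $ n"
    by (subst gf_mult) (auto intro: finite_fibres_msets_on finite_fibres_fsets_on)
  finally show ?thesis .
qed

text \<open>The factors for non-overlined parts, overlined parts and the weight combine so that \<open>f\<^sub>2\<close> cancels
  against the denominator of the logarithmic derivative.\<close>

lemma SENO_gf: "Abs_fps (\<lambda>n. int (SENO n)) * (euler_prod 1)\<^sup>2 = - fps_XD (euler_prod 2)"
proof -
  define P H S where defs: "P = gf (msets_on {0<..}) (\<lambda>_. 1) sum_mset"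
    "H = gf (msets_on {0<..}) even_sum sum_mset"
    "S = gf (fsets_on {0<..}) (\<lambda>_. 1) \<Sum>"
  have PHS: "P * euler_prod 1 = 1" "S * euler_prod 1 = euler_prod 2" "H * euler_prod 2 = - P * fps_XD (euler_prod 2)"
    unfolding defs by (rule partition_gf_limit distinct_partition_gf_limit even_sum_gf_limit)+
  have "Abs_fps (\<lambda>n. int (SENO n)) = H * S"
    by (rule fps_ext) (simp add: SENO_eq defs)
  hence "Abs_fps (\<lambda>n. int (SENO n)) * (euler_prod 1)\<^sup>2 = (H * (S * euler_prod 1)) * euler_prod 1"
    by (simp add: power2_eq_square mult_ac)
  also have "\<dots> = - ((P * euler_prod 1) * fps_XD (euler_prod 2))"
    unfolding PHS(2,3) by (simp add: mult_ac)
  also have "\<dots> = - fps_XD (euler_prod 2)"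
    unfolding PHS(1) by simp
  finally show ?thesis .
qed

theorem theorem1p8:
  fixes n :: nat
  shows "[SENO (7 * n + 5) = 0] (mod 7)"
proof -
  have "int 7 dvd Abs_fps (\<lambda>n. int (SENO n)) $ (7 * n + 5)"
  proof (rule dvd_nth_if_dvd_nth_power_mult[of 7 5 "euler_prod 1"])
    fix n
    have "euler_prod 1 ^ 7 * Abs_fps (\<lambda>n. int (SENO n)) = 
          euler_prod 1 ^ 5 * (Abs_fps (\<lambda>n. int (SENO n)) * (euler_prod 1)\<^sup>2)"
      by (simp add: mult_ac flip: power_add)
    also have "\<dots> = - (euler_prod 1 ^ 5 * fps_XD (euler_prod 2))"
      unfolding SENO_gf by simp
    finally show "int 7 dvd (euler_prod 1 ^ 7 * Abs_fps (\<lambda>n. int (SENO n))) $ (7 * n + 5)"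
      using seven_dvd_euler_prod_XD[of n] by simp
  qed auto
  hence "7 dvd SENO (7 * n + 5)"
    by (simp only: fps_nth_Abs_fps of_nat_dvd_iff)
  thus ?thesis by (simp add: cong_0_iff)
qed

end
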